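(* The graphs $G_{E_8}$ and $\overline{\Gamma}_1$ (the complement of $\Gamma_1$) are quantum isomorphic, non-isomorphic strongly regular graphs.
   Context: The $E_8$ root system $\Psi_{E_8}\subset\mathbb{R}^8$ consists of the 240 vectors $\pm e_i\pm e_j$ ($1\le i<j\le 8$) and all $x\in\{\pm1\}^8$ with $\prod_i x_i=1$. $G_{E_8}$ is the graph with vertices $v_x$, $x\in\Psi_{E_8}$, where $v_x=v_{-x}$ (120 vertices), and $v_x\sim v_y$ iff $\langle x,y\rangle=0$. The folded halved 8-cube graph has as vertices the pairs $\{x,\mathbf{1}+x\}$ for $x\in\mathbb{F}_2^8$ with $\sum_ix_i=0$ ($\mathbf{1}$ the all-ones vector), two vertices $\{x,\mathbf{1}+x\},\{y,\mathbf{1}+y\}$ being adjacent iff $x+y$ or $x+y+\mathbf{1}$ has exactly two nonzero coordinates. The graph $\Gamma_1$ (Brouwer–Ivanov–Klin) has as vertices one orbit of the independent sets of size 8 of the folded halved 8-cube graph under the group $\mathbb{Z}_2^6\times A_8$ (generated by translations by even-weight vectors and even permutations of the 8 coordinates), namely the orbit of size 120 considered by Brouwer, Ivanov and Klin; two vertices are adjacent iff the corresponding independent sets have exactly two points in common. A graph is strongly regular with parameters $(n,k,\lambda,\mu)$ if it has $n$ vertices, is $k$-regular, adjacent vertices have $\lambda$ common neighbours and distinct non-adjacent vertices have $\mu$ common neighbours. A quantum permutation matrix over a unital $C^*$-algebra $\mathcal{A}$ is $u=(u_{ij})\in M_n(\mathcal{A})$ with $u_{ij}=u_{ij}^*=u_{ij}^2$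 and $\sum_ku_{ik}=1=\sum_ku_{ki}$ for all $i$. Graphs $G_1,G_2$ on $n$ vertices are quantum isomorphic if there is a unital $C^*$-algebra $\mathcal{A}$ and a quantum permutation matrix $u\in M_n(\mathcal{A})$ with $A_{G_1}u=uA_{G_2}$, where $A_G$ denotes the adjacency matrix. *)

theory Defs
  imports Complex_Main "HOL-Combinatorics.Permutations"
begin

definition simple_graph :: "'v set \<Rightarrow> ('v \<Rightarrow> 'v \<Rightarrow> bool) \<Rightarrow> bool" where
  "simple_graph V E \<longleftrightarrow> finite V \<and>
     (\<forall>x\<in>V. \<forall>y\<in>V. E x y \<longleftrightarrow> E y x) \<and> (\<forall>x\<in>V. \<not> E x x)"

definition strongly_regular ::
  "'v set \<Rightarrow> ('v \<Rightarrow> 'v \<Rightarrow> bool) \<Rightarrow> nat \<Rightarrow> nat \<Rightarrow> nat \<Rightarrow> nat \<Rightarrow> bool" where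
  "strongly_regular V E n k l m \<longleftrightarrow> simple_graph V E \<and> card V = n \<and>
     (\<forall>x\<in>V. card {y\<in>V. E x y} = k) \<and>
     (\<forall>x\<in>V. \<forall>y\<in>V. x \<noteq> y \<and> E x y \<longrightarrow> card {z\<in>V. E x z \<and> E y z} = l) \<and>
     (\<forall>x\<in>V. \<forall>y\<in>V. x \<noteq> y \<and> \<not> E x y \<longrightarrow> card {z\<in>V. E x z \<and> E y z} = m)"

definition graph_isomorphic ::
  "'v set \<Rightarrow> ('v \<Rightarrow> 'v \<Rightarrow> bool) \<Rightarrow> 'w set \<Rightarrow> ('w \<Rightarrow> 'w \<Rightarrow> bool) \<Rightarrow> bool" where
  "graph_isomorphic V1 E1 V2 E2 \<longleftrightarrow>
     (\<exists>f. bij_betw f V1 V2 \<and> (\<forall>x\<in>V1. \<forall>y\<in>V1. E1 x y \<longleftrightarrow> E2 (f x) (f y)))"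

record 'a cstar_alg =
  cs_carrier :: "'a set"
  cs_zero :: 'a
  cs_one :: 'a
  cs_add :: "'a \<Rightarrow> 'a \<Rightarrow> 'a"
  cs_mult :: "'a \<Rightarrow> 'a \<Rightarrow> 'a"
  cs_scale :: "complex \<Rightarrow> 'a \<Rightarrow> 'a"
  cs_star :: "'a \<Rightarrow> 'a"
  cs_norm :: "'a \<Rightarrow> real"

definition cs_dist :: "'a cstar_alg \<Rightarrow> 'a \<Rightarrow> 'a \<Rightarrow> real" where
  "cs_dist A x y = cs_norm A (cs_add A x (cs_scale A (-1) y))"

definition unital_cstar_algebra :: "'a cstar_alg \<Rightarrow> bool" where
  "unital_cstar_algebra A \<longleftrightarrow> (let C = cs_carrier A; z = cs_zero A; e = cs_one A;
      add = cs_add A; mul = cs_mult A; sc = cs_scale A; st = cs_star A; nm = cs_norm A in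
   \<comment> \<open>closure\<close>
   z \<in> C \<and> e \<in> C \<and>
   (\<forall>x\<in>C. \<forall>y\<in>C. add x y \<in> C \<and> mul x y \<in> C) \<and>
   (\<forall>c. \<forall>x\<in>C. sc c x \<in> C) \<and> (\<forall>x\<in>C. st x \<in> C) \<and>
   \<comment> \<open>complex vector space\<close>
   (\<forall>x\<in>C. \<forall>y\<in>C. \<forall>w\<in>C. add (add x y) w = add x (add y w)) \<and>
   (\<forall>x\<in>C. \<forall>y\<in>C. add x y = add y x) \<and>
   (\<forall>x\<in>C. add z x = x) \<and>
   (\<forall>x\<in>C. \<exists>y\<in>C. add x y = z) \<and>
   (\<forall>c. \<forall>x\<in>C. \<forall>y\<in>C. sc c (add x y) = add (sc c x) (sc c y)) \<and>
   (\<forall>c d. \<forall>x\<in>C. sc (c + d) x = add (sc c x) (sc d x)) \<and>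
   (\<forall>c d. \<forall>x\<in>C. sc (c * d) x = sc c (sc d x)) \<and>
   (\<forall>x\<in>C. sc 1 x = x) \<and>
   \<comment> \<open>associative unital algebra\<close>
   (\<forall>x\<in>C. \<forall>y\<in>C. \<forall>w\<in>C. mul (mul x y) w = mul x (mul y w)) \<and>
   (\<forall>x\<in>C. mul e x = x \<and> mul x e = x) \<and>
   (\<forall>x\<in>C. \<forall>y\<in>C. \<forall>w\<in>C. mul x (add y w) = add (mul x y) (mul x w)) \<and>
   (\<forall>x\<in>C. \<forall>y\<in>C. \<forall>w\<in>C. mul (add x y) w = add (mul x w) (mul y w)) \<and>
   (\<forall>c. \<forall>x\<in>C. \<forall>y\<in>C. sc c (mul x y) = mul (sc c x) y \<and> sc c (mul x y) = mul x (sc c y)) \<and>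
   \<comment> \<open>involution\<close>
   (\<forall>x\<in>C. st (st x) = x) \<and>
   (\<forall>x\<in>C. \<forall>y\<in>C. st (add x y) = add (st x) (st y)) \<and>
   (\<forall>c. \<forall>x\<in>C. st (sc c x) = sc (cnj c) (st x)) \<and>
   (\<forall>x\<in>C. \<forall>y\<in>C. st (mul x y) = mul (st y) (st x)) \<and>
   \<comment> \<open>submultiplicative norm\<close>
   (\<forall>x\<in>C. nm x = 0 \<longleftrightarrow> x = z) \<and>
   (\<forall>x\<in>C. \<forall>y\<in>C. nm (add x y) \<le> nm x + nm y) \<and>
   (\<forall>c. \<forall>x\<in>C. nm (sc c x) = cmod c * nm x) \<and>
   (\<forall>x\<in>C. \<forall>y\<in>C. nm (mul x y) \<le> nm x * nm y) \<and>
   \<comment> \<open>C*-identity\<close>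
   (\<forall>x\<in>C. nm (mul (st x) x) = (nm x)\<^sup>2) \<and>
   \<comment> \<open>completeness\<close>
   (\<forall>X::nat \<Rightarrow> 'a. (\<forall>n. X n \<in> C) \<and>
        (\<forall>\<epsilon>>0. \<exists>N. \<forall>m\<ge>N. \<forall>n\<ge>N. cs_dist A (X m) (X n) < \<epsilon>) \<longrightarrow>
        (\<exists>L\<in>C. (\<lambda>n. cs_dist A (X n) L) \<longlonglongrightarrow> 0)) \<and>
   \<comment> \<open>unital (non-zero algebra)\<close>
   e \<noteq> z)"

text \<open>Finite sums in the algebra (well defined since addition is associative and commutative).\<close>
definition cs_sum :: "'a cstar_alg \<Rightarrow> ('i \<Rightarrow> 'a) \<Rightarrow> 'i set \<Rightarrow> 'a" where
  "cs_sum A f S = Finite_Set.fold (\<lambda>i acc. cs_add A (f i) acc) (cs_zero A) S"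

definition quantum_permutation_matrix ::
  "'a cstar_alg \<Rightarrow> 'v set \<Rightarrow> 'w set \<Rightarrow> ('v \<Rightarrow> 'w \<Rightarrow> 'a) \<Rightarrow> bool" where
  "quantum_permutation_matrix A V1 V2 u \<longleftrightarrow>
     (\<forall>x\<in>V1. \<forall>y\<in>V2. u x y \<in> cs_carrier A \<and> cs_star A (u x y) = u x y \<and>
                       cs_mult A (u x y) (u x y) = u x y) \<and>
     (\<forall>x\<in>V1. cs_sum A (\<lambda>y. u x y) V2 = cs_one A) \<and>
     (\<forall>y\<in>V2. cs_sum A (\<lambda>x. u x y) V1 = cs_one A)"

text \<open>A_G1 u = u A_G2, entrywise: (A_G1 u)(x,y) = sum over z adjacent to x of u z y,
  (u A_G2)(x,y) = sum over w adjacent to y of u x w.\<close>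
definition intertwines ::
  "'a cstar_alg \<Rightarrow> 'v set \<Rightarrow> ('v \<Rightarrow> 'v \<Rightarrow> bool) \<Rightarrow> 'w set \<Rightarrow> ('w \<Rightarrow> 'w \<Rightarrow> bool)
     \<Rightarrow> ('v \<Rightarrow> 'w \<Rightarrow> 'a) \<Rightarrow> bool" where
  "intertwines A V1 E1 V2 E2 u \<longleftrightarrow>
     (\<forall>x\<in>V1. \<forall>y\<in>V2. cs_sum A (\<lambda>z. u z y) {z\<in>V1. E1 x z} = cs_sum A (\<lambda>w. u x w) {w\<in>V2. E2 w y})"

definition quantum_isomorphic ::
  "'v set \<Rightarrow> ('v \<Rightarrow> 'v \<Rightarrow> bool) \<Rightarrow> 'w set \<Rightarrow> ('w \<Rightarrow> 'w \<Rightarrow> bool) \<Rightarrow> bool" where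
  "quantum_isomorphic V1 E1 V2 E2 \<longleftrightarrow> card V1 = card V2 \<and>
     (\<exists>(A :: real cstar_alg) u. unital_cstar_algebra A \<and>
        quantum_permutation_matrix A V1 V2 u \<and> intertwines A V1 E1 V2 E2 u)"

definition e8_roots :: "int list set" where
  "e8_roots =
     {x. \<exists>i j s t. i < j \<and> j < 8 \<and> s \<in> {1, -1} \<and> t \<in> {1, -1} \<and>
                  x = map (\<lambda>k. if k = i then s else if k = j then t else 0) [0..<8]}
   \<union> {x. length x = 8 \<and> set x \<subseteq> {1, -1} \<and> prod_list x = 1}"

definition ip :: "int list \<Rightarrow> int list \<Rightarrow> int" where
  "ip x y = sum_list (map (\<lambda>(a, b). a * b) (zip x y))"

definition GE8_V :: "int list set set" where
  "GE8_V = {{x, map uminus x} | x. x \<in> e8_roots}"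

definition GE8_E :: "int list set \<Rightarrow> int list set \<Rightarrow> bool" where
  "GE8_E v w \<longleftrightarrow> (\<exists>x\<in>v. \<exists>y\<in>w. ip x y = 0)"

text \<open>Vectors of F_2^8 are boolean lists of length 8 (True = 1).\<close>

definition wt :: "bool list \<Rightarrow> nat" where
  "wt x = length (filter id x)"

definition xorl :: "bool list \<Rightarrow> bool list \<Rightarrow> bool list" where
  "xorl x y = map (\<lambda>(a, b). a \<noteq> b) (zip x y)"

definition even_vec :: "bool list \<Rightarrow> bool" where
  "even_vec x \<longleftrightarrow> length x = 8 \<and> even (wt x)"

definition FH_V :: "bool list set set" where
  "FH_V = {{x, map Not x} | x. even_vec x}"

definition FH_E :: "bool list set \<Rightarrow> bool list set \<Rightarrow> bool" where
  "FH_E u v \<longleftrightarrow> (\<exists>x\<in>u. \<exists>y\<in>v. wt (xorl x y) = 2)"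

text \<open>The group Z_2^6 x A_8: x |-> (x permuted by sigma) + a, with sigma an even permutation
  of the 8 coordinates and a an even-weight vector.\<close>
definition act :: "(nat \<Rightarrow> nat) \<Rightarrow> bool list \<Rightarrow> bool list \<Rightarrow> bool list" where
  "act \<sigma> a x = map (\<lambda>i. (x ! \<sigma> i) \<noteq> (a ! i)) [0..<8]"

definition grp_elt :: "(nat \<Rightarrow> nat) \<Rightarrow> bool list \<Rightarrow> bool" where
  "grp_elt \<sigma> a \<longleftrightarrow> \<sigma> permutes {0..<8} \<and> evenperm \<sigma> \<and> even_vec a"

text \<open>Base independent set: the extended Hamming code [8,4,4] (= RM(1,3)), coordinates
  i = 0..7 read as vectors of F_2^3; codewords i |-> <a,i> + b.\<close>
definition ham :: "nat \<Rightarrow> bool list" where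
  "ham a = map (\<lambda>i. odd (card {k. k < 3 \<and> bit a k \<and> bit i k})) [0..<8]"

definition S0 :: "bool list set set" where
  "S0 = {{ham a, map Not (ham a)} | a. a < 8}"

definition Gamma1_V :: "bool list set set set" where
  "Gamma1_V = {(\<lambda>v. act \<sigma> a ` v) ` S0 | \<sigma> a. grp_elt \<sigma> a}"

definition Gamma1_E :: "bool list set set \<Rightarrow> bool list set set \<Rightarrow> bool" where
  "Gamma1_E S T \<longleftrightarrow> card (S \<inter> T) = 2"

definition Gamma1c_E :: "bool list set set \<Rightarrow> bool list set set \<Rightarrow> bool" where
  "Gamma1c_E S T \<longleftrightarrow> S \<noteq> T \<and> \<not> Gamma1_E S T"

end

theory Submission
  imports Defs "HOL-Analysis.Analysis"
begin

text \<open>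
  Both graphs live on pairs \<open>(v, \<psi>)\<close> of a non-zero vector \<open>v\<close> of \<open>V = F\<^sub>2\<^sup>4\<close> and a functional \<open>\<psi>\<close> on \<open>V\<close>,
  with the hyperbolic form \<open>B((v, \<psi>), (w, \<phi>)) = \<psi>(w) + \<phi>(v)\<close> and \<open>Q(v, \<psi>) = \<psi>(v)\<close>.
  Reduction modulo 2 identifies the lines of the \<open>E\<^sub>8\<close> root system with the pairs with \<open>Q = 1\<close>, two distinct
  ones being orthogonal iff \<open>B = 0\<close>.
  Identifying the even weight vectors modulo the all-ones vector with the alternating forms on \<open>V\<close>,
  the vertices of \<open>\<Gamma>\<^sub>1\<close> become the sets of forms \<open>\<omega>\<close> with \<open>\<omega>(v, -) = \<psi>\<close>, where \<open>Q(v, \<psi>) = 0\<close>;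
  two of them with \<open>v \<noteq> w\<close> meet in two points iff \<open>B = 0\<close> and are disjoint otherwise.

  The lines with a fixed \<open>v\<close> form an orthogonal frame. If \<open>P\<close> denotes the projection onto a line, then
  \<open>u((v, \<psi>), (w, \<phi>)) = P(v, \<psi> + \<phi>)\<close> for \<open>v = w\<close>, and \<open>0\<close> otherwise, is a quantum permutation matrix over
  the 8 by 8 complex matrices. For \<open>v \<noteq> w\<close> each half of the frame of \<open>v\<close> cut out by the value at \<open>w\<close> is
  orthogonal to a half of the frame of \<open>w\<close>, so it spans the same space as the other half,
  which is the intertwining relation.

  In the \<open>E\<^sub>8\<close> graph any two distinct non-adjacent vertices \<open>x\<close> and \<open>y\<close> have a third one, \<open>x + y\<close>, such that
  every other vertex is adjacent to an odd number of the three; this fails in the other graph.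
  Strong regularity is checked at one vertex, as linear maps act transitively on both graphs.
\<close>

section \<open>Complex matrices as a C*-algebra on the reals\<close>

text \<open>\<open>quantum_isomorphic\<close> asks for an algebra whose elements are real numbers.
  The matrix algebra is moved there along an injection built from this pairing, applied to the real
  and imaginary part of each entry and then along the list of entries.\<close>

lemma real_pairing: "\<exists>f :: real \<times> real \<Rightarrow> real. inj f"
proof -
  have "(card_of (UNIV \<times> UNIV :: (real \<times> real) set), card_of (UNIV :: real set)) \<in> ordLeq"
    using card_of_Times_same_infinite[of "UNIV :: real set"] infinite_UNIV_char_0
      ordIso_imp_ordLeq by blast
  then show ?thesis
    unfolding card_of_ordLeq[symmetric] by auto
qed

fun encode_reals :: "(real \<times> real \<Rightarrow> real) \<Rightarrow> real list \<Rightarrow> real" where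
  "encode_reals p [] = 0"
| "encode_reals p (x # xs) = p (x, encode_reals p xs)"

lemma encode_reals_inject:
  assumes "inj p" "length xs = length ys" "encode_reals p xs = encode_reals p ys"
  shows "xs = ys"
  using assms(2,3)
  by (induction xs ys rule: list_induct2) (auto dest: injD[OF assms(1)])

lemma matrix_embedding: "\<exists>f :: complex^'n^'n \<Rightarrow> real. inj f"
proof -
  obtain p :: "real \<times> real \<Rightarrow> real" where p: "inj p" using real_pairing by blast
  obtain ks :: "('n \<times> 'n) list" where ks: "set ks = UNIV"
    using finite_list[of "UNIV :: ('n \<times> 'n) set"] by auto
  let ?f = "\<lambda>M :: complex^'n^'n. encode_reals p (map (\<lambda>(i, j). p (Re (M$i$j), Im (M$i$j))) ks)"
  have "inj ?f"
  proof (rule injI)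
    fix M N assume "?f M = ?f N"
    then have "map (\<lambda>(i, j). p (Re (M$i$j), Im (M$i$j))) ks = map (\<lambda>(i, j). p (Re (N$i$j), Im (N$i$j))) ks"
      by (intro encode_reals_inject[OF p]) simp_all
    then have "p (Re (M$i$j), Im (M$i$j)) = p (Re (N$i$j), Im (N$i$j))" for i j
      using ks by (simp)
    then have "M$i$j = N$i$j" for i j
      by (simp add: complex_eq_iff inj_eq[OF p])
    then show "M = N" by (simp add: vec_eq_iff)
  qed
  then show ?thesis by blast
qed

section \<open>Adjoints, the operator norm and its completeness\<close>

definition adjoint_mat :: "complex^'n^'n \<Rightarrow> complex^'n^'n" where
  "adjoint_mat M = (\<chi> i j. cnj (M$j$i))"

definition scale_mat :: "complex \<Rightarrow> complex^'n^'n \<Rightarrow> complex^'n^'n" where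
  "scale_mat c M = (\<chi> i j. c * M$i$j)"

definition op_norm :: "complex^'n^'n \<Rightarrow> real" where
  "op_norm M = onorm ((*v) M)"

lemma bounded_linear_matrix: "bounded_linear ((*v) (M :: complex^'n^'n))"
proof -
  have "linear ((*v) M)"
    by (intro linearI) (auto simp: matrix_vector_mult_def vec_eq_iff distrib_left sum.distrib scaleR_right.sum)
  then show ?thesis by (simp add: linear_conv_bounded_linear)
qed

lemma norm_matrix_vector_le: "norm (M *v x) \<le> op_norm M * norm x"
  unfolding op_norm_def by (rule onorm[OF bounded_linear_matrix])

lemma op_norm_le: "(\<And>x. norm (M *v x) \<le> b * norm x) \<Longrightarrow> op_norm M \<le> b"
  unfolding op_norm_def by (rule onorm_le)

lemma op_norm_nonneg: "0 \<le> op_norm M"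
  unfolding op_norm_def by (rule onorm_pos_le[OF bounded_linear_matrix])

lemma adjoint_mat_adjoint: "adjoint_mat (adjoint_mat M) = M"
  by (simp add: adjoint_mat_def vec_eq_iff)

lemma adjoint_mat_add: "adjoint_mat (M + N) = adjoint_mat M + adjoint_mat N"
  by (simp add: adjoint_mat_def vec_eq_iff)

lemma adjoint_mat_scale: "adjoint_mat (scale_mat c M) = scale_mat (cnj c) (adjoint_mat M)"
  by (simp add: adjoint_mat_def scale_mat_def vec_eq_iff)

lemma adjoint_mat_mult: "adjoint_mat (M ** N) = adjoint_mat N ** adjoint_mat M"
  by (simp add: adjoint_mat_def matrix_matrix_mult_def vec_eq_iff mult.commute)

text \<open>The inner product is the real one, that is, the real part of the Hermitian product. For
  it, too, multiplication by \<open>m\<close> is adjoint to multiplication by \<open>cnj m\<close>,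
  and the claim follows entry by entry.\<close>

lemma inner_adjoint_mat: "(M *v x) \<bullet> y = x \<bullet> (adjoint_mat M *v y)"
proof -
  have "inner (m * a) b = inner a (cnj m * b)" for m a b :: complex
    by (simp add: inner_complex_def algebra_simps)
  then show ?thesis
    unfolding inner_vec_def matrix_vector_mult_def adjoint_mat_def
    by (simp add: inner_sum_left inner_sum_right) (rule sum.swap)
qed

lemma op_norm_add: "op_norm (M + N) \<le> op_norm M + op_norm N"
proof (rule op_norm_le)
  fix x
  have "norm ((M + N) *v x) \<le> norm (M *v x) + norm (N *v x)"
    by (simp add: matrix_vector_mult_add_rdistrib norm_triangle_ineq)
  also have "\<dots> \<le> (op_norm M + op_norm N) * norm x"
    using norm_matrix_vector_le[of M x] norm_matrix_vector_le[of N x] by (simp add: algebra_simps)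
  finally show "norm ((M + N) *v x) \<le> (op_norm M + op_norm N) * norm x" .
qed

lemma op_norm_mult: "op_norm (M ** N) \<le> op_norm M * op_norm N"
proof (rule op_norm_le)
  fix x
  have "norm ((M ** N) *v x) \<le> op_norm M * norm (N *v x)"
    by (simp add: norm_matrix_vector_le flip: matrix_vector_mul_assoc)
  also have "\<dots> \<le> op_norm M * (op_norm N * norm x)"
    by (intro mult_left_mono norm_matrix_vector_le op_norm_nonneg)
  finally show "norm ((M ** N) *v x) \<le> op_norm M * op_norm N * norm x" by simp
qed

lemma norm_smult_complex_vec: "norm (c *s (x :: complex^'n)) = cmod c * norm x"
  by (simp add: norm_vec_def norm_mult L2_set_right_distrib)

lemma scale_mat_vec: "scale_mat c M *v x = c *s (M *v x)"
  by (simp add: scale_mat_def matrix_vector_mult_def vec_eq_iff sum_distrib_left mult.assoc)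

lemma op_norm_scale: "op_norm (scale_mat c M) = cmod c * op_norm M"
proof -
  have le: "op_norm (scale_mat c M) \<le> cmod c * op_norm M" for c and M :: "complex^'n^'n"
    using norm_matrix_vector_le[of M]
    by (intro op_norm_le) (simp add: scale_mat_vec norm_smult_complex_vec mult.assoc mult_left_mono)
  show ?thesis
  proof (cases "c = 0")
    case True
    then show ?thesis using le[of c M] op_norm_nonneg[of "scale_mat c M"] by simp
  next
    case False
    then have "M = scale_mat (inverse c) (scale_mat c M)"
      by (simp add: scale_mat_def vec_eq_iff)
    then have "op_norm M \<le> cmod (inverse c) * op_norm (scale_mat c M)" by (metis le)
    then have "cmod c * op_norm M \<le> op_norm (scale_mat c M)"
      using False by (simp add: norm_inverse norm_divide divide_simps mult.commute split: if_splits)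
    with le show ?thesis by (intro antisym)
  qed
qed

text \<open>The squared norm of Mx is the inner product of x with (adjoint M) M x, which
  Cauchy-Schwarz bounds through the operator norm of that product.\<close>

lemma op_norm_adjoint_le: "(op_norm M)\<^sup>2 \<le> op_norm (adjoint_mat M ** M)"
proof -
  have "norm (M *v x) \<le> sqrt (op_norm (adjoint_mat M ** M)) * norm x" for x
  proof -
    have "(norm (M *v x))\<^sup>2 = x \<bullet> ((adjoint_mat M ** M) *v x)"
      by (simp add: power2_norm_eq_inner inner_adjoint_mat matrix_vector_mul_assoc)
    also have "\<dots> \<le> norm x * norm ((adjoint_mat M ** M) *v x)"
      by (rule norm_cauchy_schwarz)
    also have "\<dots> \<le> norm x * (op_norm (adjoint_mat M ** M) * norm x)"
      by (intro mult_left_mono norm_matrix_vector_le) auto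
    finally have "(norm (M *v x))\<^sup>2 \<le> op_norm (adjoint_mat M ** M) * (norm x)\<^sup>2"
      by (simp add: power2_eq_square mult_ac)
    then have "sqrt ((norm (M *v x))\<^sup>2) \<le> sqrt (op_norm (adjoint_mat M ** M) * (norm x)\<^sup>2)"
      by (rule real_sqrt_le_mono)
    then show ?thesis by (simp add: real_sqrt_mult)
  qed
  then have "op_norm M \<le> sqrt (op_norm (adjoint_mat M ** M))" by (rule op_norm_le)
  then have "(op_norm M)\<^sup>2 \<le> (sqrt (op_norm (adjoint_mat M ** M)))\<^sup>2"
    by (intro power_mono op_norm_nonneg)
  then show ?thesis using op_norm_nonneg[of "adjoint_mat M ** M"] by simp
qed

text \<open>The preceding bound and submultiplicativity give |N|^2 <= |adjoint N| |N|. Cancelling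
  |N| leaves an inequality that is applied to \<open>M\<close> and to its adjoint.\<close>

lemma op_norm_adjoint: "op_norm (adjoint_mat M) = op_norm M"
proof -
  have le: "op_norm N \<le> op_norm (adjoint_mat N)" for N :: "complex^'n^'n"
  proof (cases "op_norm N = 0")
    case True
    then show ?thesis using op_norm_nonneg by simp
  next
    case False
    then have "0 < op_norm N" using op_norm_nonneg[of N] by simp
    moreover have "op_norm N * op_norm N \<le> op_norm (adjoint_mat N) * op_norm N"
      using op_norm_adjoint_le[of N] op_norm_mult[of "adjoint_mat N" N]
      by (simp add: power2_eq_square)
    ultimately show ?thesis by simp
  qed
  show ?thesis using le[of M] le[of "adjoint_mat M"] by (simp add: adjoint_mat_adjoint)
qed

lemma op_norm_cstar: "op_norm (adjoint_mat M ** M) = (op_norm M)\<^sup>2"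
  using op_norm_adjoint_le[of M] op_norm_mult[of "adjoint_mat M" M]
  by (simp add: op_norm_adjoint power2_eq_square)

lemma norm_entry_le_op_norm: "cmod (M$i$j) \<le> op_norm (M :: complex^'n^'n)"
proof -
  have "cmod (M$i$j) = cmod ((M *v axis j 1)$i)"
    by (simp add: matrix_vector_mult_def axis_def if_distrib cong: if_cong)
  also have "\<dots> \<le> norm (M *v axis j 1)" by (rule Finite_Cartesian_Product.norm_nth_le)
  also have "\<dots> \<le> op_norm M * norm (axis j 1 :: complex^'n)" by (rule norm_matrix_vector_le)
  finally show ?thesis by simp
qed

text \<open>With \<open>norm_entry_le_op_norm\<close> this makes norm convergence the same as
  entrywise convergence, so completeness is inherited from the complex numbers.\<close>

lemma op_norm_le_entries: "op_norm M \<le> (\<Sum>i\<in>UNIV. \<Sum>j\<in>UNIV. cmod (M$i$j))"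
proof (rule op_norm_le)
  fix x
  have "norm (M *v x) \<le> (\<Sum>i\<in>UNIV. norm ((M *v x)$i))"
    unfolding norm_vec_def[of "M *v x"] by (rule L2_set_le_sum) simp
  also have "\<dots> \<le> (\<Sum>i\<in>UNIV. \<Sum>j\<in>UNIV. cmod (M$i$j) * norm x)"
  proof (rule sum_mono)
    fix i
    have "norm ((M *v x)$i) \<le> (\<Sum>j\<in>UNIV. cmod (M$i$j * x$j))"
      by (simp add: matrix_vector_mult_def norm_sum)
    also have "\<dots> \<le> (\<Sum>j\<in>UNIV. cmod (M$i$j) * norm x)"
      unfolding norm_mult by (intro sum_mono mult_left_mono Finite_Cartesian_Product.norm_nth_le) auto
    finally show "norm ((M *v x)$i) \<le> (\<Sum>j\<in>UNIV. cmod (M$i$j) * norm x)" .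
  qed
  finally show "norm (M *v x) \<le> (\<Sum>i\<in>UNIV. \<Sum>j\<in>UNIV. cmod (M$i$j)) * norm x"
    by (simp add: sum_distrib_right)
qed

lemma op_norm_zero: "op_norm (0 :: complex^'n^'n) = 0"
  using op_norm_le_entries[of "0 :: complex^'n^'n"] op_norm_nonneg[of "0 :: complex^'n^'n"] by simp

lemma op_norm_eq_zero: "op_norm M = 0 \<longleftrightarrow> M = 0"
proof
  assume "op_norm M = 0"
  then have "M$i$j = 0" for i j using norm_entry_le_op_norm[of M i j] by simp
  then show "M = 0" by (simp add: vec_eq_iff)
qed (simp add: op_norm_zero)

lemma op_norm_complete:
  fixes X :: "nat \<Rightarrow> complex^'n^'n"
  assumes "\<forall>\<epsilon>>0. \<exists>N. \<forall>m\<ge>N. \<forall>n\<ge>N. op_norm (X m - X n) < \<epsilon>"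
  shows "\<exists>L. (\<lambda>n. op_norm (X n - L)) \<longlonglongrightarrow> 0"
proof -
  have "Cauchy (\<lambda>n. X n $ i $ j)" for i j
  proof (rule metric_CauchyI)
    fix e :: real assume "0 < e"
    then obtain N where "\<forall>m\<ge>N. \<forall>n\<ge>N. op_norm (X m - X n) < e" using assms by blast
    moreover have "dist (X m $ i $ j) (X n $ i $ j) \<le> op_norm (X m - X n)" for m n
      using norm_entry_le_op_norm[of "X m - X n" i j] by (simp add: dist_norm)
    ultimately show "\<exists>N. \<forall>m\<ge>N. \<forall>n\<ge>N. dist (X m $ i $ j) (X n $ i $ j) < e"
      by (meson le_less_trans)
  qed
  then have "\<exists>l. (\<lambda>n. X n $ i $ j) \<longlonglongrightarrow> l" for i j
    by (simp add: Cauchy_convergent_iff convergent_def)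
  then obtain l where l: "(\<lambda>n. X n $ i $ j) \<longlonglongrightarrow> l i j" for i j by metis
  define L :: "complex^'n^'n" where "L = (\<chi> i j. l i j)"
  have "(\<lambda>n. \<Sum>i\<in>UNIV. \<Sum>j\<in>UNIV. cmod ((X n - L)$i$j)) \<longlonglongrightarrow> (\<Sum>i\<in>(UNIV::'n set). \<Sum>j\<in>(UNIV::'n set). 0)"
  proof (intro tendsto_sum)
    fix i j
    show "(\<lambda>n. cmod ((X n - L)$i$j)) \<longlonglongrightarrow> 0"
      using l[of i j] by (simp add: L_def LIM_zero_iff tendsto_norm_zero_iff)
  qed
  then have "(\<lambda>n. \<Sum>i\<in>UNIV. \<Sum>j\<in>UNIV. cmod ((X n - L)$i$j)) \<longlonglongrightarrow> 0" by simp
  then have "(\<lambda>n. op_norm (X n - L)) \<longlonglongrightarrow> 0"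
    by (rule tendsto_sandwich[OF always_eventually always_eventually tendsto_const, rotated 2])
       (simp_all only: op_norm_nonneg op_norm_le_entries simp_thms)
  then show ?thesis by blast
qed

section \<open>The matrix algebra transported along an injection\<close>

definition matrix_alg :: "(complex^'n^'n \<Rightarrow> 'a) \<Rightarrow> 'a cstar_alg" where
  "matrix_alg f = \<lparr>cs_carrier = range f, cs_zero = f 0, cs_one = f (mat 1),
     cs_add = (\<lambda>x y. f (inv f x + inv f y)), cs_mult = (\<lambda>x y. f (inv f x ** inv f y)),
     cs_scale = (\<lambda>c x. f (scale_mat c (inv f x))), cs_star = (\<lambda>x. f (adjoint_mat (inv f x))),
     cs_norm = (\<lambda>x. op_norm (inv f x))\<rparr>"

lemma scale_mat_simps:
  "scale_mat c (M + N) = scale_mat c M + scale_mat c N"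
  "scale_mat (c + d) M = scale_mat c M + scale_mat d M"
  "scale_mat (c * d) M = scale_mat c (scale_mat d M)"
  "scale_mat 1 M = M"
  "scale_mat (-1) M = - M"
  "scale_mat c (M ** N) = scale_mat c M ** N"
  "scale_mat c (M ** N) = M ** scale_mat c N"
  by (simp_all add: scale_mat_def vec_eq_iff algebra_simps matrix_matrix_mult_def sum_distrib_left)

lemma matrix_add_rdistrib: "(A + B) ** C = A ** C + B ** (C :: complex^'n^'n)"
  by (simp add: vec_eq_iff matrix_matrix_mult_def distrib_right sum.distrib)

lemma matrix_alg_ops:
  assumes "inj f"
  shows "cs_carrier (matrix_alg f) = range f"
    "cs_zero (matrix_alg f) = f 0"
    "cs_one (matrix_alg f) = f (mat 1)"
    "cs_add (matrix_alg f) (f M) (f N) = f (M + N)"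
    "cs_mult (matrix_alg f) (f M) (f N) = f (M ** N)"
    "cs_scale (matrix_alg f) c (f M) = f (scale_mat c M)"
    "cs_star (matrix_alg f) (f M) = f (adjoint_mat M)"
    "cs_norm (matrix_alg f) (f M) = op_norm M"
    "cs_dist (matrix_alg f) (f M) (f N) = op_norm (M - N)"
  using assms by (simp_all add: matrix_alg_def cs_dist_def scale_mat_simps)

lemma matrix_alg_complete:
  fixes f :: "complex^'n^'n \<Rightarrow> 'a"
  assumes f: "inj f"
  shows "\<forall>X::nat \<Rightarrow> 'a. (\<forall>n. X n \<in> cs_carrier (matrix_alg f)) \<and>
        (\<forall>\<epsilon>>0. \<exists>N. \<forall>m\<ge>N. \<forall>n\<ge>N. cs_dist (matrix_alg f) (X m) (X n) < \<epsilon>) \<longrightarrow>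
        (\<exists>L\<in>cs_carrier (matrix_alg f). (\<lambda>n. cs_dist (matrix_alg f) (X n) L) \<longlonglongrightarrow> 0)"
proof (intro allI impI, elim conjE)
  fix X :: "nat \<Rightarrow> 'a"
  assume X: "\<forall>n. X n \<in> cs_carrier (matrix_alg f)"
    and C: "\<forall>\<epsilon>>0. \<exists>N. \<forall>m\<ge>N. \<forall>n\<ge>N. cs_dist (matrix_alg f) (X m) (X n) < \<epsilon>"
  define Y where "Y n = inv f (X n)" for n
  have Y: "X = (\<lambda>n. f (Y n))"
    using X by (simp add: matrix_alg_ops[OF f] Y_def f_inv_into_f)
  have "\<exists>L. (\<lambda>n. op_norm (Y n - L)) \<longlonglongrightarrow> 0"
    using C by (intro op_norm_complete) (simp add: Y matrix_alg_ops[OF f])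
  then show "\<exists>L\<in>cs_carrier (matrix_alg f). (\<lambda>n. cs_dist (matrix_alg f) (X n) L) \<longlonglongrightarrow> 0"
    by (auto simp: Y matrix_alg_ops[OF f])
qed

lemma matrix_alg_unital_cstar:
  fixes f :: "complex^'n^'n \<Rightarrow> 'a"
  assumes f: "inj f"
  shows "unital_cstar_algebra (matrix_alg f)"
proof -
  have neg: "\<exists>N. M + N = 0" for M :: "complex^'n^'n" by (intro exI[of _ "- M"]) simp
  have "(mat 1 :: complex^'n^'n) \<noteq> 0" by (simp add: mat_def vec_eq_iff)
  then show ?thesis
    unfolding unital_cstar_algebra_def Let_def
    apply (intro conjI matrix_alg_complete[OF f])
                        apply (simp_all add: matrix_alg_ops[OF f] inj_eq[OF f] neg add_ac scale_mat_simps(1-5)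
        matrix_add_ldistrib matrix_add_rdistrib adjoint_mat_adjoint
        adjoint_mat_add adjoint_mat_scale adjoint_mat_mult op_norm_eq_zero op_norm_add
        op_norm_scale op_norm_mult op_norm_cstar)
    \<comment> \<open>The scalar laws for the two factors share their left side, so they are used
      from right to left, collecting scalars in front of the product.\<close>
    apply (simp_all add: matrix_mul_assoc flip: scale_mat_simps(6,7))
    done
qed

lemma matrix_alg_sum:
  assumes "inj f" "finite S"
  shows "cs_sum (matrix_alg f) (\<lambda>i. f (g i)) S = f (sum g S)"
proof -
  \<comment> \<open>As \<open>cs_add\<close> decodes its arguments with \<open>inv f\<close>, its
    results always lie in the range of \<open>f\<close>, and the fold steps commute for every
    accumulator, even one outside the carrier.\<close>
  interpret comp_fun_commute_on UNIV "\<lambda>i acc. cs_add (matrix_alg f) (f (g i)) acc"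
    using assms(1) by unfold_locales (simp add: matrix_alg_def fun_eq_iff add.left_commute)
  show ?thesis
    using assms(2)
  proof (induction S)
    case empty
    then show ?case by (simp add: cs_sum_def matrix_alg_def)
  next
    case (insert x S)
    then show ?case
      using assms(1) fold_insert[of x S] by (simp add: cs_sum_def) (simp add: matrix_alg_def)
  qed
qed

lemma quantum_isomorphicI:
  fixes u :: "'v \<Rightarrow> 'w \<Rightarrow> complex^'n^'n"
  assumes "finite V1" "finite V2" "card V1 = card V2"
    and "\<And>x y. x \<in> V1 \<Longrightarrow> y \<in> V2 \<Longrightarrow> adjoint_mat (u x y) = u x y \<and> u x y ** u x y = u x y"
    and "\<And>x. x \<in> V1 \<Longrightarrow> (\<Sum>y\<in>V2. u x y) = mat 1"
    and "\<And>y. y \<in> V2 \<Longrightarrow> (\<Sum>x\<in>V1. u x y) = mat 1"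
    and "\<And>x y. x \<in> V1 \<Longrightarrow> y \<in> V2 \<Longrightarrow> (\<Sum>z\<in>{z\<in>V1. E1 x z}. u z y) = (\<Sum>w\<in>{w\<in>V2. E2 w y}. u x w)"
  shows "quantum_isomorphic V1 E1 V2 E2"
proof -
  obtain f :: "complex^'n^'n \<Rightarrow> real" where f: "inj f" using matrix_embedding by blast
  have "quantum_permutation_matrix (matrix_alg f) V1 V2 (\<lambda>x y. f (u x y))"
    unfolding quantum_permutation_matrix_def
    using assms(4-6) matrix_alg_sum[OF f assms(1), of "\<lambda>x. u x y" for y]
      matrix_alg_sum[OF f assms(2)] f
    by (auto simp: matrix_alg_def)
  moreover have "intertwines (matrix_alg f) V1 E1 V2 E2 (\<lambda>x y. f (u x y))"
    unfolding intertwines_def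
  proof (intro ballI)
    fix x y assume "x \<in> V1" "y \<in> V2"
    then show "cs_sum (matrix_alg f) (\<lambda>z. f (u z y)) {z \<in> V1. E1 x z} =
        cs_sum (matrix_alg f) (\<lambda>w. f (u x w)) {w \<in> V2. E2 w y}"
      using assms(1,2,7) by (subst (1 2) matrix_alg_sum[OF f]) auto
  qed
  ultimately show ?thesis
    using assms(3) matrix_alg_unital_cstar[OF f] by (auto simp: quantum_isomorphic_def)
qed

section \<open>The graphs in hyperbolic coordinates\<close>

lemma bij_betw_subset_Collect:
  assumes "bij_betw f A B" "\<And>x. x \<in> A \<Longrightarrow> P x \<longleftrightarrow> Q (f x)"
  shows "bij_betw f {x\<in>A. P x} {y\<in>B. Q y}"
proof -
  have "f ` {x\<in>A. P x} = {y\<in>B. Q y}"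
    using assms by (auto simp: bij_betw_def)
  then show ?thesis using assms(1) by (auto simp: bij_betw_def inj_on_def)
qed

text \<open>An automorphism taking \<open>x\<close> to \<open>x0\<close> carries neighbourhoods and
  common neighbourhoods along, so counts at one base vertex determine all parameters.\<close>

lemma strongly_regular_transitiveI:
  assumes G: "simple_graph V E" and x0: "x0 \<in> V"
    and tr: "\<And>x. x \<in> V \<Longrightarrow> \<exists>f. bij_betw f V V \<and> (\<forall>y\<in>V. \<forall>z\<in>V. E (f y) (f z) = E y z) \<and> f x = x0"
    and n: "card V = n" and k: "card {y\<in>V. E x0 y} = k"
    and lm: "\<And>y. y \<in> V \<Longrightarrow> y \<noteq> x0 \<Longrightarrow> card {z\<in>V. E x0 z \<and> E y z} = (if E x0 y then l else m)"
  shows "strongly_regular V E n k l m"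
proof -
  have 1: "card {y\<in>V. E x y} = k" if x: "x \<in> V" for x
  proof -
    obtain f where f: "bij_betw f V V" "\<forall>y\<in>V. \<forall>z\<in>V. E (f y) (f z) = E y z" "f x = x0"
      using tr[OF x] by blast
    have "bij_betw f {y\<in>V. E x y} {y\<in>V. E x0 y}"
      by (rule bij_betw_subset_Collect[OF f(1)]) (use f x in auto)
    then show ?thesis using k bij_betw_same_card by fastforce
  qed
  have 2: "card {z\<in>V. E x z \<and> E y z} = (if E x y then l else m)" if x: "x \<in> V" "y \<in> V" "x \<noteq> y" for x y
  proof -
    obtain f where f: "bij_betw f V V" "\<forall>y\<in>V. \<forall>z\<in>V. E (f y) (f z) = E y z" "f x = x0"
      using tr[OF x(1)] by blast
    have "bij_betw f {z\<in>V. E x z \<and> E y z} {z\<in>V. E x0 z \<and> E (f y) z}"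
      by (rule bij_betw_subset_Collect[OF f(1)]) (use f x in auto)
    moreover have "f y \<in> V" "f y \<noteq> x0" "E x0 (f y) = E x y"
      using f x by (auto simp: bij_betw_def inj_on_def)
    ultimately show ?thesis using lm[of "f y"] bij_betw_same_card by fastforce
  qed
  show ?thesis using G n 1 2 by (auto simp: strongly_regular_def)
qed

section \<open>Vectors and functionals over F_2^4, and the two model graphs\<close>

datatype f24 = F24 bool bool bool bool

definition zerov :: f24 where "zerov = F24 False False False False"

fun addv :: "f24 \<Rightarrow> f24 \<Rightarrow> f24" where
  "addv (F24 a b c d) (F24 e f g h) = F24 (a \<noteq> e) (b \<noteq> f) (c \<noteq> g) (d \<noteq> h)"

fun dot :: "f24 \<Rightarrow> f24 \<Rightarrow> bool" where
  "dot (F24 a b c d) (F24 e f g h) = (((a \<and> e) \<noteq> (b \<and> f)) \<noteq> ((c \<and> g) \<noteq> (d \<and> h)))"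

definition scalev :: "bool \<Rightarrow> f24 \<Rightarrow> f24" where
  "scalev c x = (if c then x else zerov)"

lemma addv_commute: "addv x y = addv y x"
  by (cases x; cases y) auto

lemma addv_assoc: "addv (addv x y) z = addv x (addv y z)"
  by (cases x; cases y; cases z) auto

lemma addv_left_commute: "addv x (addv y z) = addv y (addv x z)"
  by (cases x; cases y; cases z) auto

lemmas addv_ac = addv_assoc addv_commute addv_left_commute

lemma addv_self [simp]: "addv x x = zerov" "addv x (addv x y) = y"
  by (cases x; cases y; auto simp: zerov_def)+

lemma addv_zerov [simp]: "addv x zerov = x" "addv zerov x = x"
  by (cases x; auto simp: zerov_def)+

lemma addv_eq_zerov [simp]: "addv x y = zerov \<longleftrightarrow> x = y"
  by (cases x; cases y) (auto simp: zerov_def)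

lemma addv_cancel [simp]: "addv x y = addv x z \<longleftrightarrow> y = z" "addv y x = addv z x \<longleftrightarrow> y = z"
  by (cases x; cases y; cases z; auto)+

lemma dot_addv [simp]:
  "dot (addv x y) z \<longleftrightarrow> dot x z \<noteq> dot y z"
  "dot z (addv x y) \<longleftrightarrow> dot z x \<noteq> dot z y"
  by (cases x; cases y; cases z; simp; argo)+

lemma dot_zerov [simp]: "\<not> dot x zerov" "\<not> dot zerov x"
  by (cases x; simp add: zerov_def)+

lemma dot_scalev [simp]: "dot (scalev c x) y \<longleftrightarrow> c \<and> dot x y" "dot y (scalev c x) \<longleftrightarrow> c \<and> dot y x"
  by (auto simp: scalev_def)

definition f24_list :: "f24 list" where
  "f24_list = [F24 a b c d. a \<leftarrow> [False, True], b \<leftarrow> [False, True], c \<leftarrow> [False, True], d \<leftarrow> [False, True]]"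

lemma set_f24_list: "set f24_list = UNIV"
proof -
  have "F24 a b c d \<in> set f24_list" for a b c d
    by (cases a; cases b; cases c; cases d; simp add: f24_list_def)
  then have "x \<in> set f24_list" for x by (metis f24.exhaust)
  then show ?thesis by blast
qed

lemma distinct_f24_list: "distinct f24_list"
  by (simp add: f24_list_def)

lemma finite_f24 [simp]: "finite (A :: f24 set)"
  by (metis List.finite_set finite_subset set_f24_list subset_UNIV)

definition hform :: "f24 \<times> f24 \<Rightarrow> f24 \<times> f24 \<Rightarrow> bool" where
  "hform x y \<longleftrightarrow> dot (fst x) (snd y) \<noteq> dot (fst y) (snd x)"

text \<open>There are 15 choices of v with 8 functionals each. For \<open>c = True\<close> this is
  the set of all vectors with Q = 1.\<close>

definition model_V :: "bool \<Rightarrow> (f24 \<times> f24) set" where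
  "model_V c = {x. fst x \<noteq> zerov \<and> dot (fst x) (snd x) = c}"

text \<open>A single formula lets both graphs share automorphisms and counts. For
  \<open>c = True\<close> two vectors with the same v have B = 0, so adjacency is orthogonality of
  distinct vectors. For \<open>c = False\<close> the formula describes the complement of meeting in
  two points, which happens for distinct first components with B = 0.\<close>

definition model_E :: "bool \<Rightarrow> f24 \<times> f24 \<Rightarrow> f24 \<times> f24 \<Rightarrow> bool" where
  "model_E c x y \<longleftrightarrow> x \<noteq> y \<and> (fst x = fst y \<or> hform x y \<noteq> c)"

lemma hform_commute: "hform x y = hform y x"
  by (auto simp: hform_def)

lemma model_E_commute: "model_E c x y = model_E c y x"
  by (auto simp: model_E_def hform_commute)

lemma simple_graph_model: "simple_graph (model_V c) (model_E c)"
proof -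
  have "finite (UNIV \<times> UNIV :: (f24 \<times> f24) set)" by (intro finite_cartesian_product finite_f24)
  then have "finite (model_V c)" by (rule rev_finite_subset) simp
  moreover have "\<not> model_E c x x" for x by (simp add: model_E_def)
  ultimately show ?thesis using model_E_commute by (auto simp: simple_graph_def)
qed

section \<open>Linear automorphisms and transitivity\<close>

definition transv :: "f24 \<Rightarrow> f24 \<Rightarrow> f24 \<times> f24 \<Rightarrow> f24 \<times> f24" where
  "transv a d x = (addv (fst x) (scalev (dot (fst x) a) d), addv (snd x) (scalev (dot d (snd x)) a))"

text \<open>The added functional is the contraction of the first component with the alternating form
  a wedge b.\<close>

definition shift :: "f24 \<Rightarrow> f24 \<Rightarrow> f24 \<times> f24 \<Rightarrow> f24 \<times> f24" where
  "shift a b x = (fst x, addv (snd x) (addv (scalev (dot (fst x) a) b) (scalev (dot (fst x) b) a)))"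

definition aut :: "bool \<Rightarrow> (f24 \<times> f24 \<Rightarrow> f24 \<times> f24) \<Rightarrow> bool" where
  "aut c f \<longleftrightarrow> bij_betw f (model_V c) (model_V c) \<and> (\<forall>x\<in>model_V c. \<forall>y\<in>model_V c. model_E c (f x) (f y) = model_E c x y)"

lemma aut_comp: "aut c f \<Longrightarrow> aut c g \<Longrightarrow> aut c (f \<circ> g)"
  by (auto simp: aut_def bij_betw_trans dest: bij_betwE)

lemma autI:
  assumes "\<And>x. f (f x) = x" "\<And>x. fst (f x) = zerov \<longleftrightarrow> fst x = zerov"
    "\<And>x y. fst (f x) = fst (f y) \<longleftrightarrow> fst x = fst y"
    "\<And>x. dot (fst (f x)) (snd (f x)) = dot (fst x) (snd x)"
    "\<And>x y. hform (f x) (f y) = hform x y"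
  shows "aut c f"
proof -
  have "f x = f y \<longleftrightarrow> x = y" for x y by (metis assms(1))
  moreover have "bij_betw f (model_V c) (model_V c)"
    by (rule bij_betw_byWitness[where f' = f]) (auto simp: assms model_V_def)
  ultimately show ?thesis by (auto simp: aut_def model_E_def assms)
qed

lemma transv_transv: "\<not> dot d a \<Longrightarrow> transv a d (transv a d x) = x"
  by (auto simp: transv_def addv_assoc prod_eq_iff)

text \<open>Functionals are moved by the contragredient of the transvection on vectors, which keeps
  the pairing and hence Q and B. Because a(d) = 0, the map is an involution and thus
  bijective.\<close>

lemma aut_transv:
  assumes "\<not> dot d a"
  shows "aut c (transv a d)"
proof (rule autI)
  define t where "t v = addv v (scalev (dot v a) d)" for v
  have "t (t v) = v" for v using assms by (auto simp: t_def addv_assoc)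
  then have "t v = t w \<longleftrightarrow> v = w" for v w by metis
  then have inj: "fst (transv a d x) = fst (transv a d y) \<longleftrightarrow> fst x = fst y" for x y
    by (simp add: transv_def t_def)
  then show "fst (transv a d x) = fst (transv a d y) \<longleftrightarrow> fst x = fst y" for x y .
  show "fst (transv a d x) = zerov \<longleftrightarrow> fst x = zerov" for x
    using inj[of x "(zerov, zerov)"] by (simp add: transv_def scalev_def)
  show "dot (fst (transv a d x)) (snd (transv a d x)) = dot (fst x) (snd x)" for x
    using assms by (auto simp: transv_def)
  show "hform (transv a d x) (transv a d y) = hform x y" for x y
    using assms by (auto simp: transv_def hform_def)
qed (rule transv_transv[OF assms])

lemma aut_shift: "aut c (shift a b)"
proof (rule autI)
  show "shift a b (shift a b x) = x" for x
    by (auto simp: shift_def addv_assoc prod_eq_iff)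
  show "dot (fst (shift a b x)) (snd (shift a b x)) = dot (fst x) (snd x)" for x
    by (auto simp: shift_def)
  show "hform (shift a b x) (shift a b y) = hform x y" for x y
    by (auto simp: shift_def hform_def)
qed (auto simp: shift_def)

definition basev :: f24 where "basev = F24 True False False False"

text \<open>If the first coordinate of v is 1, the first coordinate functional works; otherwise
  another coordinate that is 1 at v is added to it. Such a functional vanishes at v +
  \<open>basev\<close>, so it defines a transvection carrying v to \<open>basev\<close>.\<close>

lemma ex_common_functional:
  assumes "v \<noteq> zerov"
  shows "\<exists>a. dot v a \<and> dot basev a"
proof -
  have "dot v (F24 True False False False) \<or> dot v (F24 True True False False) \<or>
    dot v (F24 True False True False) \<or> dot v (F24 True False False True)"
    using assms by (cases v) (auto simp: zerov_def)
  then show ?thesis by (auto simp: basev_def)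
qed

lemma model_transitive:
  assumes x: "x \<in> model_V c"
  shows "\<exists>f. aut c f \<and> f x = (basev, scalev c basev)"
proof -
  obtain a where a: "dot (fst x) a" "dot basev a"
    using ex_common_functional[of "fst x"] x unfolding model_V_def by blast
  define f where "f = transv a (addv (fst x) basev)"
  have f: "aut c f" unfolding f_def using a by (intro aut_transv) simp
  have fx: "fst (f x) = basev" using a by (simp add: f_def transv_def scalev_def addv_ac)
  have "f x \<in> model_V c" using f x by (auto simp: aut_def bij_betw_def)
  then have dx: "dot basev (snd (f x)) = c" using fx by (auto simp: model_V_def)
  \<comment> \<open>The difference from the target functional vanishes at \<open>basev\<close>, so
    \<open>shift basev b\<close> adds exactly \<open>b\<close> to the functional and leaves
    \<open>basev\<close> alone.\<close>
  define b where "b = addv (snd (f x)) (scalev c basev)"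
  have bb: "dot basev basev" by (simp add: basev_def)
  have "\<not> dot basev b" using dx bb by (simp add: b_def)
  then have "shift basev b (f x) = (basev, scalev c basev)"
    using bb fx by (simp add: shift_def scalev_def b_def addv_ac prod_eq_iff)
  then show ?thesis using aut_comp[OF aut_shift f] by (intro exI[of _ "shift basev b \<circ> f"]) simp
qed

section \<open>Strong regularity by evaluation at the base vertex\<close>

definition model_V_list :: "bool \<Rightarrow> (f24 \<times> f24) list" where
  "model_V_list c = filter (\<lambda>x. fst x \<noteq> zerov \<and> dot (fst x) (snd x) = c) (List.product f24_list f24_list)"

lemma set_model_V_list: "set (model_V_list c) = model_V c"
  by (auto simp: model_V_list_def model_V_def set_f24_list)

lemma distinct_model_V_list: "distinct (model_V_list c)"
  by (simp add: model_V_list_def distinct_product distinct_f24_list)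

lemma card_model_V_filter: "card {x\<in>model_V c. P x} = length (filter P (model_V_list c))"
  using distinct_card[of "filter P (model_V_list c)"] distinct_model_V_list[of c]
  by (simp flip: set_model_V_list)

text \<open>The vertex list and the neighbourhood of \<open>x0\<close> are parameters, so that they
  can be evaluated once for the whole loop.\<close>

definition base_check :: "bool \<Rightarrow> (f24 \<times> f24) \<Rightarrow> (f24 \<times> f24) list \<Rightarrow> (f24 \<times> f24) list \<Rightarrow> bool" where
  "base_check c x0 vs ns \<longleftrightarrow> length vs = 120 \<and> length ns = 63 \<and>
     list_all (\<lambda>y. y = x0 \<or> length (filter (model_E c y) ns) = (if model_E c x0 y then 30 else 36)) vs"

lemma base_check_model:
  "base_check c (basev, scalev c basev) (model_V_list c) (filter (model_E c (basev, scalev c basev)) (model_V_list c))"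
proof (cases c)
  case True
  have "base_check True (basev, scalev True basev) (model_V_list True) (filter (model_E True (basev, scalev True basev)) (model_V_list True))"
    by code_simp
  then show ?thesis using True by simp
next
  case False
  have "base_check False (basev, scalev False basev) (model_V_list False) (filter (model_E False (basev, scalev False basev)) (model_V_list False))"
    by code_simp
  then show ?thesis using False by simp
qed

lemma card_model_V: "card (model_V c) = 120"
  using base_check_model[of c] card_model_V_filter[of c "\<lambda>_. True"] by (simp add: base_check_def)

lemma model_strongly_regular: "strongly_regular (model_V c) (model_E c) 120 63 30 36"
proof (rule strongly_regular_transitiveI[OF simple_graph_model])
  let ?x = "(basev, scalev c basev)"
  show "?x \<in> model_V c" by (auto simp: model_V_def basev_def zerov_def)
  show "\<exists>f. bij_betw f (model_V c) (model_V c) \<and> (\<forall>y\<in>model_V c. \<forall>z\<in>model_V c. model_E c (f y) (f z) = model_E c y z) \<and> f x = ?x"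
    if "x \<in> model_V c" for x
    using model_transitive[OF that] by (auto simp: aut_def)
  show "card (model_V c) = 120" by (rule card_model_V)
  show "card {y\<in>model_V c. model_E c ?x y} = 63"
    using base_check_model[of c] by (simp add: base_check_def card_model_V_filter)
  show "card {z\<in>model_V c. model_E c ?x z \<and> model_E c y z} = (if model_E c ?x y then 30 else 36)"
    if "y \<in> model_V c" "y \<noteq> ?x" for y
  proof -
    have "\<forall>y\<in>model_V c. y = ?x \<or>
        length (filter (model_E c y) (filter (model_E c ?x) (model_V_list c))) = (if model_E c ?x y then 30 else 36)"
      using base_check_model[of c] by (simp add: base_check_def list_all_iff set_model_V_list)
    then have "length (filter (model_E c y) (filter (model_E c ?x) (model_V_list c))) = (if model_E c ?x y then 30 else 36)"
      using that by blast
    then show ?thesis by (simp only: card_model_V_filter filter_filter)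
  qed
qed

section \<open>Non-isomorphism of the two models\<close>

lemma third_vertex:
  assumes x: "x \<in> model_V True" and y: "y \<in> model_V True" and ne: "x \<noteq> y" and na: "\<not> model_E True x y"
  obtains z where "z \<in> model_V True" "z \<noteq> x" "z \<noteq> y"
    "\<And>u. u \<in> model_V True \<Longrightarrow> u \<noteq> x \<Longrightarrow> u \<noteq> y \<Longrightarrow> u \<noteq> z \<Longrightarrow> model_E True u z \<longleftrightarrow> model_E True u x = model_E True u y"
proof -
  define z where "z = (addv (fst x) (fst y), addv (snd x) (snd y))"
  have E: "model_E True p q \<longleftrightarrow> p \<noteq> q \<and> \<not> hform p q" if "p \<in> model_V True" "q \<in> model_V True" for p q
    using that by (auto simp: model_E_def model_V_def hform_def)
  have h: "hform x y" "fst x \<noteq> fst y" using ne na by (auto simp: model_E_def)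
  \<comment> \<open>Q(x + y) = Q(x) + Q(y) + B(x, y) = 1 + 1 + 1 = 1, and the first component is
    non-zero since those of x and y differ.\<close>
  have z: "z \<in> model_V True" using x y h by (auto simp: model_V_def z_def hform_def)
  have "z \<noteq> x" "z \<noteq> y"
    using x y addv_cancel(1)[of "fst x" "fst y" zerov] addv_cancel(2)[of "fst x" "fst y" zerov]
    by (auto simp: z_def model_V_def prod_eq_iff)
  moreover have "hform u z \<longleftrightarrow> hform u x \<noteq> hform u y" for u
    by (auto simp: hform_def z_def)
  ultimately show thesis using that[OF z] E x y z by auto
qed

text \<open>No vertex completes \<open>x\<close> and \<open>y\<close> to a triple as in \<open>third_vertex\<close>.\<close>

definition no_third :: "(f24 \<times> f24) \<Rightarrow> (f24 \<times> f24) \<Rightarrow> (f24 \<times> f24) list \<Rightarrow> bool" where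
  "no_third x y vs \<longleftrightarrow> list_all (\<lambda>z. z = x \<or> z = y \<or>
     list_ex (\<lambda>u. u \<noteq> x \<and> u \<noteq> y \<and> u \<noteq> z \<and> model_E False u z \<noteq> (model_E False u x = model_E False u y)) vs) vs"

lemma no_third_model:
  "no_third (basev, zerov) (F24 False True False False, zerov) (model_V_list False)"
  by code_simp

text \<open>The pair of \<open>no_third_model\<close> is pulled back along the isomorphism. The
  third vertex of the preimages would map to a third vertex of that pair, which was
  excluded.\<close>

lemma model_not_isomorphic: "\<not> graph_isomorphic (model_V True) (model_E True) (model_V False) (model_E False)"
proof
  assume "graph_isomorphic (model_V True) (model_E True) (model_V False) (model_E False)"
  then obtain f where f: "bij_betw f (model_V True) (model_V False)"
    and E: "\<And>x y. x \<in> model_V True \<Longrightarrow> y \<in> model_V True \<Longrightarrow> model_E True x y = model_E False (f x) (f y)"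
    by (auto simp: graph_isomorphic_def)
  let ?x = "(basev, zerov)" and ?y = "(F24 False True False False, zerov)"
  have V: "?x \<in> model_V False" "?y \<in> model_V False" by (auto simp: model_V_def basev_def zerov_def)
  then obtain x y where xy: "x \<in> model_V True" "y \<in> model_V True" "f x = ?x" "f y = ?y"
    using f by (metis bij_betw_imp_surj_on imageE)
  have inj: "f p = f q \<longleftrightarrow> p = q" if "p \<in> model_V True" "q \<in> model_V True" for p q
    using f that by (auto simp: bij_betw_def inj_on_def)
  have "\<not> model_E False ?x ?y" by (simp add: model_E_def hform_def basev_def)
  then have "\<not> model_E True x y" using E xy by simp
  moreover have "x \<noteq> y" using xy by (auto simp: basev_def)
  ultimately obtain z where z: "z \<in> model_V True" "z \<noteq> x" "z \<noteq> y"
    "\<And>u. u \<in> model_V True \<Longrightarrow> u \<noteq> x \<Longrightarrow> u \<noteq> y \<Longrightarrow> u \<noteq> z \<Longrightarrow> model_E True u z \<longleftrightarrow> model_E True u x = model_E True u y"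
    using third_vertex xy by metis
  have "f z \<in> model_V False" "f z \<noteq> ?x" "f z \<noteq> ?y"
    using z xy f inj by (auto simp: bij_betw_def simp flip: xy(3,4))
  then obtain w where w: "w \<in> model_V False" "w \<noteq> ?x" "w \<noteq> ?y" "w \<noteq> f z"
    "model_E False w (f z) \<noteq> (model_E False w ?x = model_E False w ?y)"
    using no_third_model unfolding no_third_def list_all_iff list_ex_iff set_model_V_list by blast
  then obtain u where u: "u \<in> model_V True" "w = f u" using f by (metis bij_betw_imp_surj_on imageE)
  have "u \<noteq> x" "u \<noteq> y" "u \<noteq> z" using w u xy by auto
  then have "model_E True u z \<longleftrightarrow> model_E True u x = model_E True u y" using z u by blast
  then show False using w u xy z E by simp
qed

section \<open>The root system\<close>

text \<open>Roots are scaled to norm 8, so the roots \<open>\<plusminus>e\<^sub>i \<plusminus> e\<^sub>j\<close> get the factor 2; then \<open>\<langle>x, a\<rangle>/4\<close> is an integer for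
  every \<open>a\<close> in the correspondingly scaled lattice. The eight vectors below have norm 16 and form a
  hyperbolic basis of \<open>E\<^sub>8/2E\<^sub>8\<close>.\<close>

definition scaled_odd :: "int list \<Rightarrow> int list \<Rightarrow> bool" where
  "scaled_odd x a \<longleftrightarrow> ((if 0 \<in> set x then 2 else 1) * ip x a) mod 8 \<noteq> 0"

definition e8_coords :: "int list \<Rightarrow> f24 \<times> f24" where
  "e8_coords x =
    (F24 (scaled_odd x [3, 1, 1, 1, 1, 1, 1, -1]) (scaled_odd x [2, 2, 2, 0, -2, 0, 0, 0])
         (scaled_odd x [2, 2, 0, 0, 0, 2, 0, 2]) (scaled_odd x [2, 0, 0, 2, 2, -2, 0, 0]),
     F24 (scaled_odd x [4, 0, 0, 0, 0, 0, 0, 0]) (scaled_odd x [2, 2, 2, -2, 0, 0, 0, 0])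
         (scaled_odd x [2, 2, 0, 0, 0, 2, -2, 0]) (scaled_odd x [2, 0, 2, 0, 0, 0, 2, 2]))"

definition short_root :: "nat \<Rightarrow> nat \<Rightarrow> int \<Rightarrow> int \<Rightarrow> int list" where
  "short_root i j s t = map (\<lambda>k. if k = i then s else if k = j then t else 0) [0..<8]"

text \<open>One root from each line, the one whose first non-zero entry is 1: 28 times 2 of the
  first kind and 64 of the second.\<close>

definition root_list :: "int list list" where
  "root_list =
    [short_root i j 1 t. i \<leftarrow> [0..<8], j \<leftarrow> [Suc i..<8], t \<leftarrow> [1, -1]] @
    map ((#) 1) (filter (\<lambda>x. prod_list x = 1) (List.n_lists 7 [1, -1]))"

lemma ip_uminus: "ip (map uminus x) y = - ip x y" "ip x (map uminus y) = - ip x y"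
  by (induction x y rule: list_induct2') (auto simp: ip_def)

lemma set_root_list: "set root_list =
    {x. \<exists>i j t. i < j \<and> j < 8 \<and> t \<in> {1, -1} \<and> x = short_root i j 1 t} \<union>
    {x. \<exists>y. length y = 7 \<and> set y \<subseteq> {1, -1} \<and> prod_list y = 1 \<and> x = 1 # y}"
proof -
  have "set [short_root i j 1 t. i \<leftarrow> [0..<8], j \<leftarrow> [Suc i..<8], t \<leftarrow> [1, -1]] =
      (\<Union>i\<in>{0..<8}. \<Union>j\<in>{Suc i..<8}. short_root i j 1 ` {1, -1})"
    by simp
  also have "\<dots> = {x. \<exists>i j t. i < j \<and> j < 8 \<and> t \<in> {1, -1} \<and> x = short_root i j 1 t}"
  proof (intro equalityI subsetI)
    fix x assume "x \<in> {x. \<exists>i j t. i < j \<and> j < 8 \<and> t \<in> {1, -1} \<and> x = short_root i j 1 t}"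
    then obtain i j t where "i < j" "j < 8" "t \<in> {1, -1}" "x = short_root i j 1 t" by blast
    moreover from this have "i \<in> {0..<8}" "j \<in> {Suc i..<8}" by auto
    ultimately show "x \<in> (\<Union>i\<in>{0..<8}. \<Union>j\<in>{Suc i..<8}. short_root i j 1 ` {1, -1})" by blast
  next
    fix x assume "x \<in> (\<Union>i\<in>{0..<8}. \<Union>j\<in>{Suc i..<8}. short_root i j 1 ` {1, -1})"
    then obtain i j t where "j \<in> {Suc i..<8}" "t \<in> {1, -1}" "x = short_root i j 1 t" by blast
    moreover from this have "i < j" "j < 8" by auto
    ultimately show "x \<in> {x. \<exists>i j t. i < j \<and> j < 8 \<and> t \<in> {1, -1} \<and> x = short_root i j 1 t}" by blast
  qed
  finally show ?thesis
    unfolding root_list_def set_append by (auto simp: set_n_lists image_iff)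
qed

lemma root_list_subset: "set root_list \<subseteq> e8_roots"
  unfolding set_root_list e8_roots_def short_root_def
  by (intro Un_mono) (blast, force)

lemma prod_list_uminus: "prod_list (map uminus x) = (-1 :: int) ^ length x * prod_list x"
  by (induction x) auto

lemma e8_roots_cases:
  assumes "x \<in> e8_roots"
  shows "x \<in> set root_list \<or> map uminus x \<in> set root_list"
proof -
  have long: "short_root i j 1 t \<in> set root_list" if "i < j" "j < 8" "t \<in> {1, -1}" for i j t
    using that unfolding set_root_list by blast
  have short: "1 # y \<in> set root_list" if "length y = 7" "set y \<subseteq> {1, -1}" "prod_list y = 1" for y
    using that unfolding set_root_list by blast
  from assms consider i j s t where "i < j" "j < 8" "s \<in> {1, -1}" "t \<in> {1, -1}"
      "x = short_root i j s t"
    | "length x = 8" "set x \<subseteq> {1, -1}" "prod_list x = 1"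
    unfolding e8_roots_def short_root_def by blast
  then show ?thesis
  proof cases
    case 1
    show ?thesis
    proof (cases "s = 1")
      case True
      then show ?thesis using 1 long[of i j t] by auto
    next
      case False
      then have "map uminus x = short_root i j 1 (- t)"
        using 1 by (auto simp: short_root_def)
      then show ?thesis using 1 long[of i j "- t"] by auto
    qed
  next
    case 2
    then obtain h y where x: "x = h # y" "length y = 7" by (cases x) auto
    show ?thesis
    proof (cases "h = 1")
      case True
      then show ?thesis using short[of y] 2 x by auto
    next
      case False
      then have "h = -1" using 2 x by auto
      \<comment> \<open>The last seven entries have product -1, and negating an odd number of
        entries makes it 1.\<close>
      then have "1 # map uminus y \<in> set root_list"
        using 2 x by (intro short) (auto simp: prod_list_uminus)
      then show ?thesis using x \<open>h = -1\<close> by auto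
    qed
  qed
qed

lemma GE8_V_root_list: "GE8_V = (\<lambda>x. {x, map uminus x}) ` set root_list"
proof -
  have uu: "map uminus (map uminus x) = x" for x :: "int list" by (simp add: comp_def)
  show ?thesis
  proof (intro equalityI subsetI)
    fix v assume "v \<in> GE8_V"
    then obtain x where x: "x \<in> e8_roots" "v = {x, map uminus x}" by (auto simp: GE8_V_def)
    show "v \<in> (\<lambda>x. {x, map uminus x}) ` set root_list"
    proof (cases "x \<in> set root_list")
      case True
      then show ?thesis using x by auto
    next
      case False
      then have "map uminus x \<in> set root_list" using e8_roots_cases[OF x(1)] by simp
      moreover have "v = {map uminus x, map uminus (map uminus x)}" using x uu[of x] by auto
      ultimately show ?thesis by (rule rev_image_eqI)
    qed
  next
    fix v assume "v \<in> (\<lambda>x. {x, map uminus x}) ` set root_list"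
    then show "v \<in> GE8_V" using root_list_subset by (auto simp: GE8_V_def)
  qed
qed

lemma length_root_list: "length root_list = 120"
  by code_simp

lemma root_list_coords:
  "list_all (\<lambda>x. length x = 8 \<and> dot (fst (e8_coords x)) (snd (e8_coords x)) \<and>
     e8_coords (map uminus x) = e8_coords x) root_list"
  by code_simp

text \<open>\<open>sorted_wrt\<close> visits each unordered pair once, with the coordinates attached
  beforehand. The same pass shows that the 120 coordinate vectors are distinct.\<close>

lemma root_list_pairs:
  "sorted_wrt (\<lambda>(x, k) (y, l). k \<noteq> l \<and> (ip x y = 0) = (\<not> hform k l)) (map (\<lambda>x. (x, e8_coords x)) root_list)"
  by code_simp

text \<open>Eight times the resolution of the identity into the projections onto the lines of
  \<open>xs\<close>. The roots have norm 2 or 8, so the division is exact and the test stays in the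
  integers.\<close>

definition frame_check :: "int list list \<Rightarrow> bool" where
  "frame_check xs \<longleftrightarrow> list_all (\<lambda>i. list_all (\<lambda>j.
     sum_list (map (\<lambda>x. (8 div ip x x) * (x ! i * x ! j)) xs) = (if i = j then 8 else 0)) [0..<8]) [0..<8]"

lemma root_list_norms: "list_all (\<lambda>x. ip x x dvd 8 \<and> ip x x \<noteq> 0) root_list"
  by code_simp

lemma root_list_frames:
  "list_all (\<lambda>v. v = zerov \<or>
     frame_check (map fst (filter (\<lambda>(x, k). fst k = v) (map (\<lambda>x. (x, e8_coords x)) root_list)))) f24_list"
  by code_simp

lemma e8_coords_facts:
  shows "inj_on e8_coords (set root_list)" and "distinct root_list"
    and "\<And>x y. x \<in> set root_list \<Longrightarrow> y \<in> set root_list \<Longrightarrow> x \<noteq> y \<Longrightarrow>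
      ip x y = 0 \<longleftrightarrow> \<not> hform (e8_coords x) (e8_coords y)"
proof -
  have "sorted_wrt (\<lambda>x y. e8_coords x \<noteq> e8_coords y \<and>
      (ip x y = 0) = (\<not> hform (e8_coords x) (e8_coords y))) root_list"
    using root_list_pairs by (simp add: sorted_wrt_map)
  then have nth: "e8_coords (root_list ! i) \<noteq> e8_coords (root_list ! j) \<and>
      (ip (root_list ! i) (root_list ! j) = 0) = (\<not> hform (e8_coords (root_list ! i)) (e8_coords (root_list ! j)))"
    if "i < j" "j < length root_list" for i j
    using that by (simp add: sorted_wrt_iff_nth_less)
  have "distinct (map e8_coords root_list)"
    unfolding distinct_conv_nth
  proof (intro allI impI)
    fix i j assume "i < length (map e8_coords root_list)" "j < length (map e8_coords root_list)" "i \<noteq> j"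
    then show "map e8_coords root_list ! i \<noteq> map e8_coords root_list ! j"
      using nth[of i j] nth[of j i] by (cases "i < j") auto
  qed
  then show "inj_on e8_coords (set root_list)" "distinct root_list" by (simp_all add: distinct_map)
  fix x y assume "x \<in> set root_list" "y \<in> set root_list" "x \<noteq> y"
  then obtain i j where ij: "i < length root_list" "j < length root_list" "x = root_list ! i" "y = root_list ! j"
    by (metis in_set_conv_nth)
  then have "i < j \<or> j < i" using \<open>x \<noteq> y\<close> by (cases i j rule: linorder_cases) auto
  moreover have "ip y x = ip x y"
    unfolding ip_def by (subst zip_commute) (simp add: comp_def case_prod_unfold mult.commute)
  ultimately show "ip x y = 0 \<longleftrightarrow> \<not> hform (e8_coords x) (e8_coords y)"
    using nth[of i j] nth[of j i] ij hform_commute by metis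
qed

lemma e8_coords_root_list:
  assumes "x \<in> set root_list"
  shows "length x = 8" "e8_coords x \<in> model_V True" "e8_coords (map uminus x) = e8_coords x"
    "ip x x dvd 8" "ip x x \<noteq> 0"
  using root_list_coords root_list_norms assms dot_zerov
  by (auto simp: list_all_iff model_V_def)

text \<open>An injection between sets of 120 elements is onto, so surjectivity is obtained by
  counting.\<close>

lemma bij_betw_e8_coords: "bij_betw e8_coords (set root_list) (model_V True)"
proof -
  have "card (e8_coords ` set root_list) = card (model_V True)"
    using e8_coords_facts(1,2) length_root_list by (simp add: card_image distinct_card card_model_V)
  moreover have "finite (model_V True)" using simple_graph_model by (auto simp: simple_graph_def)
  moreover have "e8_coords ` set root_list \<subseteq> model_V True" using e8_coords_root_list by blast
  ultimately have "e8_coords ` set root_list = model_V True" by (intro card_subset_eq)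
  then show ?thesis using e8_coords_facts(1) by (simp add: bij_betw_def)
qed

definition root_of :: "f24 \<times> f24 \<Rightarrow> int list" where
  "root_of = inv_into (set root_list) e8_coords"

lemma root_of: "p \<in> model_V True \<Longrightarrow> root_of p \<in> set root_list" "p \<in> model_V True \<Longrightarrow> e8_coords (root_of p) = p"
  using bij_betw_e8_coords unfolding root_of_def
  by (auto simp: bij_betw_def inv_into_into f_inv_into_f)

lemma bij_betw_root_of: "bij_betw root_of (model_V True) (set root_list)"
  unfolding root_of_def by (rule bij_betw_inv_into[OF bij_betw_e8_coords])

lemma ip_root_of:
  assumes "p \<in> model_V True" "q \<in> model_V True"
  shows "ip (root_of p) (root_of q) = 0 \<longleftrightarrow> model_E True p q"
proof (cases "p = q")
  case True
  then show ?thesis using e8_coords_root_list(5)[OF root_of(1)] assms by (auto simp: model_E_def)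
next
  case False
  then have "root_of p \<noteq> root_of q" using root_of assms by metis
  then have "ip (root_of p) (root_of q) = 0 \<longleftrightarrow> \<not> hform p q"
    using e8_coords_facts(3)[of "root_of p" "root_of q"] root_of assms by simp
  moreover have "model_E True p q \<longleftrightarrow> \<not> hform p q"
    using False assms by (auto simp: model_E_def model_V_def hform_def)
  ultimately show ?thesis by simp
qed

definition e8_line :: "f24 \<times> f24 \<Rightarrow> int list set" where
  "e8_line p = {root_of p, map uminus (root_of p)}"

lemma bij_betw_e8_line: "bij_betw e8_line (model_V True) GE8_V"
proof -
  \<comment> \<open>Opposite roots have equal coordinates, while distinct listed roots have
    different ones; hence no two listed roots are opposite.\<close>
  have "inj_on (\<lambda>x. {x, map uminus x}) (set root_list)"
  proof (rule inj_onI)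
    fix x y :: "int list" assume xy: "x \<in> set root_list" "y \<in> set root_list" "{x, map uminus x} = {y, map uminus y}"
    then have "x = y \<or> x = map uminus y" by (auto simp: doubleton_eq_iff)
    then have "e8_coords x = e8_coords y" using e8_coords_root_list(3)[OF xy(2)] by auto
    then show "x = y" using e8_coords_facts(1) xy by (simp add: inj_on_eq_iff)
  qed
  then have "bij_betw (\<lambda>x. {x, map uminus x}) (set root_list) GE8_V"
    by (simp add: bij_betw_def GE8_V_root_list)
  from bij_betw_trans[OF bij_betw_root_of this] show ?thesis
    by (simp add: e8_line_def[abs_def] comp_def)
qed

lemma GE8_E_e8_line:
  assumes "p \<in> model_V True" "q \<in> model_V True"
  shows "GE8_E (e8_line p) (e8_line q) \<longleftrightarrow> model_E True p q"
  using ip_root_of[OF assms] by (auto simp: GE8_E_def e8_line_def ip_uminus)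

section \<open>Projections onto root lines and frames\<close>

definition idx8 :: "8 \<Rightarrow> nat" where
  "idx8 = (SOME f. bij_betw f UNIV {..<8})"

lemma bij_betw_idx8: "bij_betw idx8 UNIV {..<8}"
proof -
  have "\<exists>f :: 8 \<Rightarrow> nat. bij_betw f UNIV {..<8}"
    by (intro finite_same_card_bij) simp_all
  then show ?thesis unfolding idx8_def by (rule someI_ex)
qed

lemma sum_idx8: "(\<Sum>i\<in>UNIV. g (idx8 i)) = (\<Sum>k<8. g k)"
  by (rule sum.reindex_bij_betw[OF bij_betw_idx8])

lemma ip_sum: "length x = 8 \<Longrightarrow> length y = 8 \<Longrightarrow> ip x y = (\<Sum>k<8. x ! k * y ! k)"
  by (simp add: ip_def sum_list_sum_nth atLeast0LessThan)

definition line_proj :: "int list \<Rightarrow> complex^8^8" where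
  "line_proj x = (\<chi> i j. of_int (x ! idx8 i * x ! idx8 j) / of_int (ip x x))"

lemma adjoint_line_proj: "adjoint_mat (line_proj x) = line_proj x"
  by (simp add: line_proj_def adjoint_mat_def vec_eq_iff mult.commute)

lemma line_proj_mult:
  assumes "length x = 8" "length y = 8"
  shows "(line_proj x ** line_proj y) $ i $ j =
    of_int (x ! idx8 i * y ! idx8 j) * of_int (ip x y) / (of_int (ip x x) * of_int (ip y y))"
proof -
  define g :: "nat \<Rightarrow> complex" where
    "g k = of_int (x ! idx8 i * y ! idx8 j) / (of_int (ip x x) * of_int (ip y y)) * of_int (x ! k * y ! k)" for k
  have "(line_proj x ** line_proj y) $ i $ j = (\<Sum>k\<in>UNIV. g (idx8 k))"
    by (simp add: line_proj_def matrix_matrix_mult_def g_def field_simps)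
  also have "\<dots> = (\<Sum>k<8. g k)" by (rule sum_idx8)
  also have "\<dots> = of_int (x ! idx8 i * y ! idx8 j) / (of_int (ip x x) * of_int (ip y y)) * of_int (ip x y)"
    using assms by (simp add: g_def ip_sum[of x y] sum_distrib_left)
  finally show ?thesis by simp
qed

lemma line_proj_idem:
  "length x = 8 \<Longrightarrow> ip x x \<noteq> 0 \<Longrightarrow> line_proj x ** line_proj x = line_proj x"
  by (simp add: vec_eq_iff line_proj_mult) (simp add: line_proj_def)

lemma line_proj_orthogonal:
  "length x = 8 \<Longrightarrow> length y = 8 \<Longrightarrow> ip x y = 0 \<Longrightarrow> line_proj x ** line_proj y = 0"
  by (simp add: vec_eq_iff line_proj_mult)

lemma line_proj_frame:
  assumes "frame_check xs" "distinct xs" "\<And>x. x \<in> set xs \<Longrightarrow> ip x x dvd 8 \<and> ip x x \<noteq> 0"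
  shows "(\<Sum>x\<in>set xs. line_proj x) = mat 1"
proof -
  have "(\<Sum>x\<in>set xs. line_proj x) $ i $ j = mat 1 $ i $ j" for i j
  proof -
    have ij: "idx8 i < 8" "idx8 j < 8" using bij_betw_idx8 by (auto simp: bij_betw_def)
    have eq: "idx8 i = idx8 j \<longleftrightarrow> i = j" using bij_betw_idx8 by (auto simp: bij_betw_def inj_eq)
    \<comment> \<open>Every norm divides 8, so multiplication by 8 clears the denominators and
      leaves the integer identity of \<open>frame_check\<close>.\<close>
    have "8 * (\<Sum>x\<in>set xs. line_proj x) $ i $ j =
        (\<Sum>x\<in>set xs. of_int ((8 div ip x x) * (x ! idx8 i * x ! idx8 j)))"
      unfolding sum_component sum_distrib_left
    proof (rule sum.cong)
      fix x assume "x \<in> set xs"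
      then have "ip x x dvd 8" "ip x x \<noteq> 0" using assms by auto
      then show "8 * line_proj x $ i $ j = of_int (8 div ip x x * (x ! idx8 i * x ! idx8 j))"
        by (simp add: line_proj_def of_int_div)
    qed simp
    also have "\<dots> = of_int (sum_list (map (\<lambda>x. (8 div ip x x) * (x ! idx8 i * x ! idx8 j)) xs))"
      using assms(2) by (simp add: sum_list_distinct_conv_sum_set)
    also have "\<dots> = (if i = j then 8 else 0)"
      using assms(1) ij eq by (simp add: frame_check_def list_all_iff)
    finally show ?thesis by (simp add: mat_def split: if_splits)
  qed
  then show ?thesis by (simp add: vec_eq_iff)
qed

definition vproj :: "f24 \<times> f24 \<Rightarrow> complex^8^8" where
  "vproj p = line_proj (root_of p)"

lemma vproj_props:
  shows "adjoint_mat (vproj p) = vproj p"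
    and "p \<in> model_V True \<Longrightarrow> vproj p ** vproj p = vproj p"
    and "p \<in> model_V True \<Longrightarrow> q \<in> model_V True \<Longrightarrow> model_E True p q \<Longrightarrow> vproj p ** vproj q = 0"
  using root_of(1) e8_coords_root_list ip_root_of
  by (simp_all add: vproj_def adjoint_line_proj line_proj_idem line_proj_orthogonal)

lemma vproj_frame:
  assumes "v \<noteq> zerov"
  shows "(\<Sum>p\<in>{p\<in>model_V True. fst p = v}. vproj p) = mat 1"
proof -
  let ?xs = "filter (\<lambda>x. fst (e8_coords x) = v) root_list"
  have "bij_betw root_of {p\<in>model_V True. fst p = v} {x\<in>set root_list. fst (e8_coords x) = v}"
    by (rule bij_betw_subset_Collect[OF bij_betw_root_of]) (simp add: root_of)
  then have "(\<Sum>p\<in>{p\<in>model_V True. fst p = v}. vproj p) = (\<Sum>x\<in>set ?xs. line_proj x)"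
    unfolding vproj_def by (simp add: sum.reindex_bij_betw)
  also have "\<dots> = mat 1"
  proof (rule line_proj_frame)
    have "map fst (filter (\<lambda>(x, k). fst k = v) (map (\<lambda>x. (x, e8_coords x)) root_list)) = ?xs"
      by (simp add: filter_map comp_def)
    then show "frame_check ?xs" using root_list_frames assms unfolding list_all_iff set_f24_list by (metis UNIV_I)
    show "distinct ?xs" using e8_coords_facts(2) by simp
    show "ip x x dvd 8 \<and> ip x x \<noteq> 0" if "x \<in> set ?xs" for x
      using that e8_coords_root_list by simp
  qed
  finally show ?thesis .
qed

lemma sum_vproj_split:
  fixes Q :: "f24 \<times> f24 \<Rightarrow> bool"
  assumes "v \<noteq> zerov"
  defines "H \<equiv> \<lambda>e. \<Sum>p\<in>{p\<in>model_V True. fst p = v \<and> Q p = e}. vproj p"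
  shows "H e + H (\<not> e) = mat 1"
proof -
  have "finite (model_V True)" using simple_graph_model by (auto simp: simple_graph_def)
  then have "H e + H (\<not> e) = (\<Sum>p\<in>{p\<in>model_V True. fst p = v \<and> Q p = e} \<union> {p\<in>model_V True. fst p = v \<and> Q p = (\<not> e)}. vproj p)"
    unfolding H_def by (intro sum.union_disjoint[symmetric]) auto
  also have "{p\<in>model_V True. fst p = v \<and> Q p = e} \<union> {p\<in>model_V True. fst p = v \<and> Q p = (\<not> e)} = {p\<in>model_V True. fst p = v}"
    by auto
  finally show ?thesis using vproj_frame[OF assms(1)] by simp
qed

lemma matrix_sum_mult_zero:
  fixes f :: "'a \<Rightarrow> complex^'n^'n" and g :: "'b \<Rightarrow> complex^'n^'n"
  assumes "\<And>x y. x \<in> A \<Longrightarrow> y \<in> B \<Longrightarrow> f x ** g y = 0"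
  shows "sum f A ** sum g B = 0"
proof -
  have l: "sum h A ** M = (\<Sum>x\<in>A. h x ** M)" for h :: "'a \<Rightarrow> complex^'n^'n" and M :: "complex^'n^'n"
    by (induction A rule: infinite_finite_induct) (auto simp: matrix_add_rdistrib)
  have r: "M ** sum h B = (\<Sum>x\<in>B. M ** h x)" for h :: "'b \<Rightarrow> complex^'n^'n" and M :: "complex^'n^'n"
    by (induction B rule: infinite_finite_induct) (auto simp: matrix_add_ldistrib)
  show ?thesis unfolding l unfolding r using assms by simp
qed

text \<open>Let A(e) be the part of the frame of v with value e at w, and B(e) the part of the frame
  of w with value e at v. Vectors from A(e) and B(e) have form value e + e = 0, so A(e) B(e) = 0 for
  both e. Inserting A(e) + A(not e) = 1 and then B(e) + B(not e) = 1 gives B(e) = A(not e) B(e) =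
  A(not e).\<close>

lemma half_frames_agree:
  assumes v: "v \<noteq> zerov" and w: "w \<noteq> zerov" and vw: "v \<noteq> w"
  shows "(\<Sum>p\<in>{p\<in>model_V True. fst p = w \<and> dot v (snd p) = e}. vproj p) =
    (\<Sum>p\<in>{p\<in>model_V True. fst p = v \<and> dot w (snd p) = (\<not> e)}. vproj p)"
proof -
  define A where "A e = (\<Sum>p\<in>{p\<in>model_V True. fst p = v \<and> dot w (snd p) = e}. vproj p)" for e
  define B where "B e = (\<Sum>p\<in>{p\<in>model_V True. fst p = w \<and> dot v (snd p) = e}. vproj p)" for e
  have AB: "A e ** B e = 0" for e
    unfolding A_def B_def
    by (rule matrix_sum_mult_zero, rule vproj_props(3)) (use vw in \<open>auto simp: model_E_def hform_def\<close>)
  have A1: "A e + A (\<not> e) = mat 1" for e unfolding A_def by (rule sum_vproj_split[OF v])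
  have B1: "B e + B (\<not> e) = mat 1" for e unfolding B_def by (rule sum_vproj_split[OF w])
  have "B e = (A e + A (\<not> e)) ** B e" using A1 by simp
  also have "\<dots> = A (\<not> e) ** B e" by (simp add: matrix_add_rdistrib AB)
  also have "\<dots> = A (\<not> e) ** (B e + B (\<not> e))" by (simp add: matrix_add_ldistrib AB)
  also have "\<dots> = A (\<not> e)" using B1 by simp
  finally show ?thesis unfolding A_def B_def .
qed

section \<open>The quantum permutation matrix and the intertwining relation\<close>

definition magic :: "f24 \<times> f24 \<Rightarrow> f24 \<times> f24 \<Rightarrow> complex^8^8" where
  "magic x y = (if fst x = fst y then vproj (fst x, addv (snd x) (snd y)) else 0)"

lemma sum_if_fst:
  assumes "finite A"
  shows "(\<Sum>z\<in>A. if fst z = v then f z else 0) = (\<Sum>z\<in>{z\<in>A. fst z = v}. f z)"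
  using assms by (simp add: sum.inter_filter)

text \<open>Adding \<phi> changes the value at w by d, hence Q from c to c + d. In this way a row or
  column of \<open>magic\<close> is reindexed by the frame of w.\<close>

lemma bij_betw_translate:
  assumes "dot w \<phi> = d"
  shows "bij_betw (\<lambda>z. (fst z, addv (snd z) \<phi>)) {z\<in>model_V c. fst z = w \<and> P z}
     {p\<in>model_V (c \<noteq> d). fst p = w \<and> P (fst p, addv (snd p) \<phi>)}"
proof (rule bij_betw_byWitness[where f' = "\<lambda>z. (fst z, addv (snd z) \<phi>)"])
qed (use assms in \<open>auto simp: model_V_def addv_assoc\<close>)

lemma magic_left:
  assumes y: "y \<in> model_V False"
  shows "(\<Sum>z\<in>{z\<in>model_V True. P z}. magic z y) =
    (\<Sum>p\<in>{p\<in>model_V True. fst p = fst y \<and> P (fst p, addv (snd p) (snd y))}. vproj p)"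
proof -
  have fin: "finite (model_V True)" using simple_graph_model by (auto simp: simple_graph_def)
  have "(\<Sum>z\<in>{z\<in>model_V True. P z}. magic z y) =
      (\<Sum>z\<in>{z\<in>model_V True. fst z = fst y \<and> P z}. vproj (fst z, addv (snd z) (snd y)))"
    unfolding magic_def using fin by (subst sum_if_fst) (auto intro: sum.cong)
  also have "\<dots> = (\<Sum>p\<in>{p\<in>model_V True. fst p = fst y \<and> P (fst p, addv (snd p) (snd y))}. vproj p)"
    using bij_betw_translate[of "fst y" "snd y" False True P] y
    by (intro sum.reindex_bij_betw) (simp add: model_V_def)
  finally show ?thesis .
qed

lemma magic_right:
  assumes x: "x \<in> model_V True"
  shows "(\<Sum>z\<in>{z\<in>model_V False. P z}. magic x z) =
    (\<Sum>p\<in>{p\<in>model_V True. fst p = fst x \<and> P (fst p, addv (snd p) (snd x))}. vproj p)"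
proof -
  have fin: "finite (model_V False)" using simple_graph_model by (auto simp: simple_graph_def)
  have m: "magic x z = (if fst z = fst x then vproj (fst z, addv (snd z) (snd x)) else 0)" for z
    by (auto simp: magic_def addv_commute)
  have "(\<Sum>z\<in>{z\<in>model_V False. P z}. magic x z) =
      (\<Sum>z\<in>{z\<in>model_V False. fst z = fst x \<and> P z}. vproj (fst z, addv (snd z) (snd x)))"
    unfolding m using fin by (subst sum_if_fst) (auto intro: sum.cong)
  also have "\<dots> = (\<Sum>p\<in>{p\<in>model_V True. fst p = fst x \<and> P (fst p, addv (snd p) (snd x))}. vproj p)"
    using bij_betw_translate[of "fst x" "snd x" True False P] x
    by (intro sum.reindex_bij_betw) (simp add: model_V_def)
  finally show ?thesis .
qed

lemma addv_eq_iff: "x = addv y z \<longleftrightarrow> addv y x = z"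
  by (cases x; cases y; cases z) auto

lemma magic_props:
  assumes x: "x \<in> model_V True" and y: "y \<in> model_V False"
  shows "adjoint_mat (magic x y) = magic x y" "magic x y ** magic x y = magic x y"
    "(\<Sum>z\<in>model_V False. magic x z) = mat 1" "(\<Sum>z\<in>model_V True. magic z y) = mat 1"
    "(\<Sum>z\<in>{z\<in>model_V True. model_E True x z}. magic z y) = (\<Sum>z\<in>{z\<in>model_V False. model_E False z y}. magic x z)"
proof -
  show "adjoint_mat (magic x y) = magic x y"
    by (simp add: magic_def vproj_props) (simp add: adjoint_mat_def vec_eq_iff)
  have "(fst x, addv (snd x) (snd y)) \<in> model_V True" if "fst x = fst y"
    using x y that by (auto simp: model_V_def)
  then show "magic x y ** magic x y = magic x y"
    by (simp add: magic_def vproj_props)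
  have v: "fst x \<noteq> zerov" and w: "fst y \<noteq> zerov" using x y by (auto simp: model_V_def)
  show "(\<Sum>z\<in>model_V False. magic x z) = mat 1"
    using magic_right[OF x, of "\<lambda>_. True"] vproj_frame[OF v] by simp
  show "(\<Sum>z\<in>model_V True. magic z y) = mat 1"
    using magic_left[OF y, of "\<lambda>_. True"] vproj_frame[OF w] by simp
  show "(\<Sum>z\<in>{z\<in>model_V True. model_E True x z}. magic z y) = (\<Sum>z\<in>{z\<in>model_V False. model_E False z y}. magic x z)"
  proof (cases "fst x = fst y")
    case True
    \<comment> \<open>For equal first components both graphs join all distinct vertices, and
      \<open>snd x = addv (snd p) (snd y)\<close> says the same as
      \<open>addv (snd p) (snd x) = snd y\<close>.\<close>
    have "model_E True x (fst p, addv (snd p) (snd y)) \<longleftrightarrow> model_E False (fst p, addv (snd p) (snd x)) y"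
      if "fst p = fst y" for p
      using True that addv_eq_iff[of "snd x" "snd p" "snd y"] by (simp add: model_E_def prod_eq_iff)
    then show ?thesis
      unfolding magic_left[OF y] magic_right[OF x] using True by (intro sum.cong) auto
  next
    case False
    \<comment> \<open>\<open>e\<close> is B(x, y), and translating the functional of
      \<open>p\<close> adds it to the form value. Adjacency thus becomes the value \<open>e\<close>
      on the left, where B must be 0, and the opposite value on the right, where B must be
      1.\<close>
    define e where "e \<longleftrightarrow> dot (fst x) (snd y) \<noteq> dot (fst y) (snd x)"
    have 1: "{p\<in>model_V True. fst p = fst y \<and> model_E True x (fst p, addv (snd p) (snd y))} =
        {p\<in>model_V True. fst p = fst y \<and> dot (fst x) (snd p) = e}"
      using False by (auto simp: model_E_def hform_def e_def)
    have 2: "{p\<in>model_V True. fst p = fst x \<and> model_E False (fst p, addv (snd p) (snd x)) y} =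
        {p\<in>model_V True. fst p = fst x \<and> dot (fst y) (snd p) = (\<not> e)}"
      using False by (auto simp: model_E_def hform_def e_def)
    show ?thesis
      unfolding magic_left[OF y] magic_right[OF x] 1 2 by (rule half_frames_agree[OF v w False])
  qed
qed

lemma quantum_isomorphic_model_images:
  assumes f: "bij_betw f (model_V True) V1" and g: "bij_betw g (model_V False) V2"
    and E1: "\<And>p q. p \<in> model_V True \<Longrightarrow> q \<in> model_V True \<Longrightarrow> E1 (f p) (f q) = model_E True p q"
    and E2: "\<And>p q. p \<in> model_V False \<Longrightarrow> q \<in> model_V False \<Longrightarrow> E2 (g p) (g q) = model_E False p q"
  shows "quantum_isomorphic V1 E1 V2 E2"
proof -
  have fin: "finite (model_V c)" for c using simple_graph_model by (auto simp: simple_graph_def)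
  define F where "F = inv_into (model_V True) f"
  define G where "G = inv_into (model_V False) g"
  have F: "F x \<in> model_V True" "f (F x) = x" if "x \<in> V1" for x
    using f that unfolding F_def by (auto simp: bij_betw_def inv_into_into f_inv_into_f)
  have G: "G y \<in> model_V False" "g (G y) = y" if "y \<in> V2" for y
    using g that unfolding G_def by (auto simp: bij_betw_def inv_into_into f_inv_into_f)
  have bF: "bij_betw F V1 (model_V True)" unfolding F_def by (rule bij_betw_inv_into[OF f])
  have bG: "bij_betw G V2 (model_V False)" unfolding G_def by (rule bij_betw_inv_into[OF g])
  show ?thesis
  proof (rule quantum_isomorphicI[where u = "\<lambda>x y. magic (F x) (G y)"])
    show "finite V1" using fin[of True] bij_betw_finite[OF f] by simp
    show "finite V2" using fin[of False] bij_betw_finite[OF g] by simp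
    show "card V1 = card V2"
      using bij_betw_same_card[OF f] bij_betw_same_card[OF g] by (simp add: card_model_V)
  next
    fix x y assume xy: "x \<in> V1" "y \<in> V2"
    note m = magic_props[OF F(1)[OF xy(1)] G(1)[OF xy(2)]]
    show "adjoint_mat (magic (F x) (G y)) = magic (F x) (G y) \<and>
        magic (F x) (G y) ** magic (F x) (G y) = magic (F x) (G y)"
      using m by simp
    have "(\<Sum>z\<in>{z\<in>V1. E1 x z}. magic (F z) (G y)) = (\<Sum>z\<in>{z\<in>model_V True. model_E True (F x) z}. magic z (G y))"
      by (rule sum.reindex_bij_betw, rule bij_betw_subset_Collect[OF bF]) (metis E1 F xy(1))
    moreover have "(\<Sum>w\<in>{w\<in>V2. E2 w y}. magic (F x) (G w)) = (\<Sum>z\<in>{z\<in>model_V False. model_E False z (G y)}. magic (F x) z)"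
      by (rule sum.reindex_bij_betw, rule bij_betw_subset_Collect[OF bG]) (metis E2 G xy(2))
    ultimately show "(\<Sum>z\<in>{z\<in>V1. E1 x z}. magic (F z) (G y)) = (\<Sum>w\<in>{w\<in>V2. E2 w y}. magic (F x) (G w))"
      using m(5) by simp
  next
    fix x assume x: "x \<in> V1"
    \<comment> \<open>Any vertex of the other model serves to instantiate \<open>magic_props\<close>
      for the row sum of \<open>x\<close>.\<close>
    have "(basev, zerov) \<in> model_V False" by (simp add: model_V_def basev_def zerov_def)
    from magic_props(3)[OF F(1)[OF x] this]
    show "(\<Sum>y\<in>V2. magic (F x) (G y)) = mat 1"
      using sum.reindex_bij_betw[OF bG, of "magic (F x)"] by simp
  next
    fix y assume y: "y \<in> V2"
    have "(basev, basev) \<in> model_V True" by (simp add: model_V_def basev_def zerov_def)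
    from magic_props(4)[OF this G(1)[OF y]]
    show "(\<Sum>x\<in>V1. magic (F x) (G y)) = mat 1"
      using sum.reindex_bij_betw[OF bF, of "\<lambda>x. magic x (G y)"] by simp
  qed
qed

section \<open>Hamming codes and alternating forms\<close>

abbreviation swp :: "nat \<Rightarrow> nat \<Rightarrow> nat \<Rightarrow> nat" where
  "swp \<equiv> Transposition.transpose"

datatype f26 = F26 bool bool bool bool bool bool

text \<open>A linear isometry from the even vectors with \<open>wt/2\<close> to the alternating forms with the Pfaffian,
  whose kernel is spanned by the all-ones vector. The entries of \<open>F26\<close> are the coefficients with indices
  12, 13, 14, 23, 24, 34; the first three vanish exactly on the Hamming code.\<close>

definition form_of :: "bool list \<Rightarrow> f26" where
  "form_of x = F26 ((x!4 \<noteq> x!5) \<noteq> (x!6 \<noteq> x!7)) ((x!2 \<noteq> x!3) \<noteq> (x!6 \<noteq> x!7)) ((x!1 \<noteq> x!3) \<noteq> (x!5 \<noteq> x!7))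
     ((x!1 \<noteq> x!2) \<noteq> (x!4 \<noteq> x!6)) ((x!2 \<noteq> x!3) \<noteq> (x!4 \<noteq> x!7)) ((x!3 \<noteq> x!4) \<noteq> (x!5 \<noteq> x!6))"

text \<open>The functional \<omega>(v, -) of the alternating form \<omega> with the given
  coefficients. For non-zero v the forms with \<omega>(v, -) = 0 come from the quotient of V by v,
  so there are eight of them.\<close>

fun contract :: "f26 \<Rightarrow> f24 \<Rightarrow> f24" where
  "contract (F26 p q r s t u) (F24 a b c d) =
    F24 ((b \<and> p) \<noteq> ((c \<and> q) \<noteq> (d \<and> r))) ((a \<and> p) \<noteq> ((c \<and> s) \<noteq> (d \<and> t)))
        ((a \<and> q) \<noteq> ((b \<and> s) \<noteq> (d \<and> u))) ((a \<and> r) \<noteq> ((b \<and> t) \<noteq> (c \<and> u)))"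

text \<open>The Hodge dual exchanges the two families of maximal totally singular subspaces.\<close>

fun hodge :: "bool \<Rightarrow> f26 \<Rightarrow> f26" where
  "hodge False w = w"
| "hodge True (F26 p q r s t u) = F26 u t s r q p"

lemma dot_contract: "\<not> dot v (contract w v)"
  by (cases w; cases v) auto

lemma form_of_Not: "length x = 8 \<Longrightarrow> form_of (map Not x) = form_of x"
  by (auto simp: form_of_def)

lemma xorl_nth: "length x = 8 \<Longrightarrow> length y = 8 \<Longrightarrow> i < 8 \<Longrightarrow> xorl x y ! i = (x ! i \<noteq> y ! i)"
  by (simp add: xorl_def)

lemma length_xorl: "length x = 8 \<Longrightarrow> length y = 8 \<Longrightarrow> length (xorl x y) = 8"
  by (simp add: xorl_def)

lemma xorl_xorl: "length x = 8 \<Longrightarrow> length y = 8 \<Longrightarrow> xorl (xorl x y) y = x"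
  by (rule nth_equalityI) (auto simp: xorl_nth length_xorl)

fun addf :: "f26 \<Rightarrow> f26 \<Rightarrow> f26" where
  "addf (F26 a b c d e f) (F26 g h i j k l) = F26 (a \<noteq> g) (b \<noteq> h) (c \<noteq> i) (d \<noteq> j) (e \<noteq> k) (f \<noteq> l)"

lemma contract_addf: "contract (addf w m) v = addv (contract w v) (contract m v)"
  by (cases w; cases m; cases v; simp; intro conjI; argo)

lemma form_of_xorl:
  "length x = 8 \<Longrightarrow> length y = 8 \<Longrightarrow> form_of (xorl x y) = addf (form_of x) (form_of y)"
  by (simp add: form_of_def xorl_nth; intro conjI; argo)

lemma odd_wt_xorl:
  "length x = length y \<Longrightarrow> odd (wt (xorl x y)) \<longleftrightarrow> odd (wt x) \<noteq> odd (wt y)"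
  by (induction x y rule: list_induct2) (auto simp: wt_def xorl_def)

lemma even_vec_xorl: "even_vec x \<Longrightarrow> even_vec y \<Longrightarrow> even_vec (xorl x y)"
  using odd_wt_xorl[of x y] by (auto simp: even_vec_def length_xorl)

lemma even_vec_Not: "even_vec x \<Longrightarrow> even_vec (map Not x)"
proof -
  have "wt x + wt (map Not x) = length x" by (induction x) (auto simp: wt_def)
  then show "even_vec x \<Longrightarrow> even_vec (map Not x)"
    unfolding even_vec_def by (metis dvd_add_right_iff even_numeral length_map numeral_Bit0 even_add)
qed

definition even_list :: "bool list list" where
  "even_list = filter (\<lambda>x. even (wt x)) (List.n_lists 8 [False, True])"

lemma set_even_list: "set even_list = {x. even_vec x}"
proof -
  have "set x \<subseteq> {False, True}" for x by auto
  then show ?thesis by (auto simp: even_list_def set_n_lists even_vec_def)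
qed

lemma distinct_even_list: "distinct even_list"
  by (simp add: even_list_def distinct_n_lists)

text \<open>When non-empty, a translate of the linear code of words whose form contracts with v to
  zero.\<close>

definition coset :: "f24 \<Rightarrow> f24 \<Rightarrow> bool list set" where
  "coset v \<psi> = {x. even_vec x \<and> contract (form_of x) v = \<psi>}"

definition pts :: "bool list set \<Rightarrow> bool list set set" where
  "pts C = (\<lambda>x. {x, map Not x}) ` C"

definition gvertex :: "f24 \<times> f24 \<Rightarrow> bool list set set" where
  "gvertex p = pts (coset (fst p) (snd p))"

lemma Not_Not: "map Not (map Not x) = x"
  by (simp add: comp_def)

lemma coset_Not: "x \<in> coset v \<psi> \<Longrightarrow> map Not x \<in> coset v \<psi>"
  by (auto simp: coset_def even_vec_Not form_of_Not even_vec_def) (use even_vec_Not even_vec_def in blast)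

text \<open>Cosets are closed under complementation, so a common point has both of its words in both
  cosets.\<close>

lemma gvertex_Int: "gvertex p \<inter> gvertex q = pts (coset (fst p) (snd p) \<inter> coset (fst q) (snd q))"
proof (intro equalityI subsetI)
  fix P assume "P \<in> gvertex p \<inter> gvertex q"
  then obtain x y where xy: "x \<in> coset (fst p) (snd p)" "y \<in> coset (fst q) (snd q)"
    "P = {x, map Not x}" "P = {y, map Not y}" by (auto simp: gvertex_def pts_def)
  then have "x = y \<or> x = map Not y" by (auto simp: doubleton_eq_iff)
  then have "x \<in> coset (fst q) (snd q)" using xy coset_Not by auto
  then show "P \<in> pts (coset (fst p) (snd p) \<inter> coset (fst q) (snd q))" using xy by (auto simp: pts_def)
qed (auto simp: gvertex_def pts_def)

definition half_forms :: "f26 list" where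
  "half_forms = map form_of (filter (\<lambda>x. \<not> hd x) even_list)"

text \<open>Each point has exactly one word starting with \<open>False\<close>, so points are
  counted by the forms of these 64 words.\<close>

lemma card_gvertex_Int:
  "card (gvertex p \<inter> gvertex q) =
    length (filter (\<lambda>w. contract w (fst q) = snd q) (filter (\<lambda>w. contract w (fst p) = snd p) half_forms))"
proof -
  define D where "D = coset (fst p) (snd p) \<inter> coset (fst q) (snd q)"
  have len: "length x = 8" if "x \<in> D" for x using that by (simp add: D_def coset_def even_vec_def)
  have hd: "hd (map Not x) = (\<not> hd x)" if "x \<in> D" for x using len[OF that] by (cases x) auto
  have "pts D = pts {x\<in>D. \<not> hd x}"
  proof (intro equalityI subsetI)
    fix P assume "P \<in> pts D"
    then obtain x where x: "x \<in> D" "P = {x, map Not x}" by (auto simp: pts_def)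
    show "P \<in> pts {x\<in>D. \<not> hd x}"
    proof (cases "hd x")
      case True
      then have "map Not x \<in> {x\<in>D. \<not> hd x}" using x coset_Not hd[OF x(1)] by (auto simp: D_def)
      moreover have "P = {map Not x, map Not (map Not x)}" unfolding Not_Not using x by auto
      ultimately show ?thesis unfolding pts_def by (rule rev_image_eqI)
    next
      case False
      then show ?thesis using x by (auto simp: pts_def)
    qed
  qed (auto simp: pts_def)
  moreover have "inj_on (\<lambda>x. {x, map Not x}) {x\<in>D. \<not> hd x}"
    by (rule inj_onI) (auto simp: doubleton_eq_iff hd)
  ultimately have "card (pts D) = card {x\<in>D. \<not> hd x}" by (simp add: pts_def card_image)
  also have "{x\<in>D. \<not> hd x} = set (filter (\<lambda>x. contract (form_of x) (fst q) = snd q)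
      (filter (\<lambda>x. contract (form_of x) (fst p) = snd p) (filter (\<lambda>x. \<not> hd x) even_list)))"
    by (auto simp: D_def coset_def set_even_list)
  also have "card \<dots> = length (filter (\<lambda>x. contract (form_of x) (fst q) = snd q)
      (filter (\<lambda>x. contract (form_of x) (fst p) = snd p) (filter (\<lambda>x. \<not> hd x) even_list)))"
    by (intro distinct_card distinct_filter distinct_even_list)
  finally show ?thesis
    unfolding gvertex_Int D_def[symmetric] half_forms_def by (simp add: filter_map comp_def)
qed

text \<open>With p = (v, \<psi>) and d = \<psi>(w), the condition on \<phi> is B(p, (w, \<phi>)) =
  0. The list \<open>ms\<close> holds the contractions with w of the eight forms of p, shared by all
  \<phi>.\<close>

definition row_check :: "f24 \<Rightarrow> bool \<Rightarrow> f24 \<Rightarrow> f24 list \<Rightarrow> bool" where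
  "row_check v d w ms \<longleftrightarrow> list_all (\<lambda>\<phi>. if dot w \<phi> then True
     else length (filter (\<lambda>m. m = \<phi>) ms) = (if dot v \<phi> = d then 2 else 0)) f24_list"

definition vertex_check :: "f24 \<times> f24 \<Rightarrow> f26 list \<Rightarrow> bool" where
  "vertex_check p ws \<longleftrightarrow> length ws = 8 \<and>
     list_all (\<lambda>w. w = zerov \<or> w = fst p \<or> row_check (fst p) (dot w (snd p)) w (map (\<lambda>m. contract m w) ws)) f24_list"

definition all_vertex_check :: "f26 list \<Rightarrow> bool" where
  "all_vertex_check ws \<longleftrightarrow> list_all (\<lambda>p. vertex_check p (filter (\<lambda>w. contract w (fst p) = snd p) ws)) (model_V_list False)"

lemma all_vertex_check: "all_vertex_check half_forms"
  by code_simp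

text \<open>For v different from w, the equations \<omega>(v, -) = \<psi> and \<omega>(w, -) =
  \<phi> force \<psi>(w) = \<omega>(v, w) = \<phi>(v), that is B = 0. The solutions then form a
  coset of the alternating forms on the quotient by the span of v and w, of which there are two. The
  evaluated check confirms these counts.\<close>

lemma card_gvertex_Int_eq:
  assumes p: "p \<in> model_V False" and q: "q \<in> model_V False"
  shows "card (gvertex p \<inter> gvertex q) = (if p = q then 8 else if model_E False p q then 0 else 2)"
proof -
  let ?ws = "filter (\<lambda>w. contract w (fst p) = snd p) half_forms"
  have "vertex_check p ?ws"
    using all_vertex_check p unfolding all_vertex_check_def list_all_iff set_model_V_list by blast
  then have vc: "length ?ws = 8"
    "\<And>w. w \<noteq> zerov \<Longrightarrow> w \<noteq> fst p \<Longrightarrow> row_check (fst p) (dot w (snd p)) w (map (\<lambda>m. contract m w) ?ws)"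
    unfolding vertex_check_def list_all_iff set_f24_list by blast+
  show ?thesis
  proof (cases "fst p = fst q")
    case True
    then have "filter (\<lambda>w. contract w (fst q) = snd q) ?ws = (if p = q then ?ws else [])"
      by (auto simp: prod_eq_iff filter_empty_conv)
    then show ?thesis unfolding card_gvertex_Int using True vc(1) by (auto simp: model_E_def)
  next
    case False
    have "row_check (fst p) (dot (fst q) (snd p)) (fst q) (map (\<lambda>m. contract m (fst q)) ?ws)" "\<not> dot (fst q) (snd q)"
      using vc(2)[of "fst q"] q False by (auto simp: model_V_def)
    then have "length (filter (\<lambda>m. m = snd q) (map (\<lambda>m. contract m (fst q)) ?ws)) =
        (if dot (fst p) (snd q) = dot (fst q) (snd p) then 2 else 0)"
      unfolding row_check_def list_all_iff set_f24_list by (metis UNIV_I)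
    then show ?thesis
      unfolding card_gvertex_Int using False by (auto simp: filter_map comp_def model_E_def hform_def)
  qed
qed

text \<open>A vertex meets itself in eight points, and the vertex of another pair in at most
  two.\<close>

lemma inj_on_gvertex: "inj_on gvertex (model_V False)"
proof (rule inj_onI)
  fix p q assume pq: "p \<in> model_V False" "q \<in> model_V False" "gvertex p = gvertex q"
  then have "card (gvertex p \<inter> gvertex q) = 8" using card_gvertex_Int_eq[OF pq(1,1)] by simp
  then show "p = q" using card_gvertex_Int_eq[OF pq(1,2)] by (simp split: if_splits)
qed

lemma Gamma1c_E_gvertex:
  assumes "p \<in> model_V False" "q \<in> model_V False"
  shows "Gamma1c_E (gvertex p) (gvertex q) \<longleftrightarrow> model_E False p q"
  using card_gvertex_Int_eq[OF assms] inj_on_eq_iff[OF inj_on_gvertex assms]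
  by (auto simp: Gamma1c_E_def Gamma1_E_def model_E_def)

section \<open>Coordinate permutations and the two families of codes\<close>

definition perm_word :: "(nat \<Rightarrow> nat) \<Rightarrow> bool list \<Rightarrow> bool list" where
  "perm_word p x = map (\<lambda>i. x ! p i) [0..<8]"

text \<open>The preimage under \<open>form_of\<close> of a maximal totally singular subspace from
  the family selected by \<open>b\<close>.\<close>

definition code :: "bool \<Rightarrow> f24 \<Rightarrow> bool list set" where
  "code b v = {x. even_vec x \<and> contract (hodge b (form_of x)) v = zerov}"

definition family :: "bool \<Rightarrow> bool list set set" where
  "family b = {code b v | v. v \<noteq> zerov}"

definition code_list :: "bool \<Rightarrow> f24 \<Rightarrow> (bool list \<times> f26) list \<Rightarrow> bool list list" where
  "code_list b v xs = map fst (filter (\<lambda>(x, w). contract (hodge b w) v = zerov) xs)"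

definition even_forms :: "(bool list \<times> f26) list" where
  "even_forms = map (\<lambda>x. (x, form_of x)) even_list"

lemma code_list: "code b v = set (code_list b v even_forms)" "distinct (code_list b v even_forms)"
proof -
  have eq: "code_list b v even_forms = filter (\<lambda>x. contract (hodge b (form_of x)) v = zerov) even_list"
    by (simp add: code_list_def even_forms_def filter_map comp_def)
  show "code b v = set (code_list b v even_forms)" by (auto simp: eq code_def set_even_list)
  show "distinct (code_list b v even_forms)" by (simp add: eq distinct_even_list)
qed

text \<open>Only containment in a code is tested; equality follows in \<open>swp_0_family\<close>,
  since all codes have 16 words.\<close>

definition some_code :: "bool \<Rightarrow> f26 list \<Rightarrow> bool" where
  "some_code b ws \<longleftrightarrow> list_ex (\<lambda>v. v \<noteq> zerov \<and> list_all (\<lambda>w. contract (hodge b w) v = zerov) ws) f24_list"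

definition swap_check :: "bool \<Rightarrow> bool list list \<Rightarrow> bool" where
  "swap_check b xs \<longleftrightarrow> length xs = 16 \<and>
     list_all (\<lambda>i. list_all (\<lambda>x. even (wt (perm_word (swp 0 i) x))) xs \<and>
        some_code b (map (\<lambda>x. form_of (perm_word (swp 0 i) x)) xs)) [1, 2, 3, 4, 5, 6, 7]"

definition all_swap_check :: "bool \<Rightarrow> (bool list \<times> f26) list \<Rightarrow> bool" where
  "all_swap_check b xs \<longleftrightarrow> list_all (\<lambda>v. v = zerov \<or> swap_check (\<not> b) (code_list b v xs)) f24_list"

text \<open>A transposition exchanges the two families. Those moving 0 are tested here, and
  \<open>swp_family\<close> reaches the others by conjugation.\<close>

lemma all_swap_check: "all_swap_check b even_forms"
proof (cases b)
  case True
  have "all_swap_check True even_forms" by code_simp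
  then show ?thesis using True by simp
next
  case False
  have "all_swap_check False even_forms" by code_simp
  then show ?thesis using False by simp
qed

text \<open>Two distinct transpositions moving 0 compose to a 3-cycle. These even permutations
  already carry the code of \<open>basev\<close> to every other code of its family.\<close>

definition reach_check :: "bool list list \<Rightarrow> bool" where
  "reach_check xs \<longleftrightarrow> list_all (\<lambda>v. v = zerov \<or> v = basev \<or>
     list_ex (\<lambda>i. list_ex (\<lambda>j. i \<noteq> j \<and>
       list_all (\<lambda>x. contract (form_of (perm_word (swp 0 j) (perm_word (swp 0 i) x))) v = zerov) xs)
       [1, 2, 3, 4, 5, 6, 7]) [1, 2, 3, 4, 5, 6, 7]) f24_list"

lemma reach_check: "reach_check (code_list False basev even_forms)"
  by code_simp

text \<open>Every functional vanishing at v has the form \<omega>(v, -), so translations by even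
  words reach all functionals over v.\<close>

definition shift_check :: "(bool list \<times> f26) list \<Rightarrow> bool" where
  "shift_check xs \<longleftrightarrow> list_all (\<lambda>p. list_ex (\<lambda>(x, w). contract w (fst p) = snd p) xs) (model_V_list False)"

lemma shift_check: "shift_check even_forms"
  by code_simp

text \<open>Permuting the indices of a word is a right action, hence the reversed order.\<close>

lemma perm_word_comp:
  assumes "q permutes {0..<8}"
  shows "perm_word (p \<circ> q) x = perm_word q (perm_word p x)"
proof -
  have "q i < 8" if "i < 8" for i using permutes_in_image[OF assms, of i] that by simp
  then show ?thesis by (auto simp: perm_word_def)
qed

lemma swp_permutes: "i < 8 \<Longrightarrow> j < 8 \<Longrightarrow> swp i j permutes {0..<8}"
  by (intro permutes_swap_id) auto

lemma perm_word_id: "length x = 8 \<Longrightarrow> perm_word id x = x"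
  unfolding perm_word_def id_apply by (metis map_nth)

lemma perm_word_swp: "i < 8 \<Longrightarrow> j < 8 \<Longrightarrow> length x = 8 \<Longrightarrow> perm_word (swp i j) (perm_word (swp i j) x) = x"
  by (simp add: perm_word_id flip: perm_word_comp[OF swp_permutes])

lemma card_code:
  assumes "v \<noteq> zerov"
  shows "card (code b v) = 16" "finite (code b v)"
proof -
  have "swap_check (\<not> b) (code_list b v even_forms)"
    using all_swap_check[of b] assms unfolding all_swap_check_def list_all_iff set_f24_list by blast
  then have "length (code_list b v even_forms) = 16" by (simp add: swap_check_def)
  then show "card (code b v) = 16" "finite (code b v)"
    by (simp_all add: code_list distinct_card)
qed

lemma swp_0_family:
  assumes i: "0 < i" "i < 8" and C: "C \<in> family b"
  shows "perm_word (swp 0 i) ` C \<in> family (\<not> b)"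
proof -
  obtain v where v: "v \<noteq> zerov" "C = code b v" using C by (auto simp: family_def)
  let ?f = "perm_word (swp 0 i)"
  have i': "i \<in> set [1, 2, 3, 4, 5, 6, 7]" using i by auto
  have "swap_check (\<not> b) (code_list b v even_forms)"
    using all_swap_check[of b] v unfolding all_swap_check_def list_all_iff set_f24_list by blast
  then have ev: "\<forall>x\<in>C. even (wt (?f x))"
    and sc: "some_code (\<not> b) (map (\<lambda>x. form_of (?f x)) (code_list b v even_forms))"
    using i' unfolding swap_check_def list_all_iff v(2) code_list(1) by blast+
  obtain w where w: "w \<noteq> zerov" "\<forall>x\<in>C. contract (hodge (\<not> b) (form_of (?f x))) w = zerov"
    using sc by (auto simp: some_code_def list_ex_iff list_all_iff v(2) code_list(1))
  have "?f ` C \<subseteq> code (\<not> b) w"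
    using ev w by (auto simp: code_def even_vec_def perm_word_def)
  moreover have "inj_on ?f C"
    by (rule inj_on_inverseI[where g = ?f]) (use i in \<open>auto simp: v(2) code_def even_vec_def perm_word_swp\<close>)
  then have "card (?f ` C) = card (code (\<not> b) w)"
    using card_code v w by (simp add: card_image)
  ultimately have "?f ` C = code (\<not> b) w" using card_code(2)[OF w(1)] by (intro card_subset_eq)
  then show ?thesis using w by (auto simp: family_def)
qed

text \<open>Since (i j) = (i 0)(0 j)(i 0), the families are exchanged three times.\<close>

lemma swp_family:
  assumes ij: "i < 8" "j < 8" "i \<noteq> j" and C: "C \<in> family b"
  shows "perm_word (swp i j) ` C \<in> family (\<not> b)"
proof (cases "i = 0 \<or> j = 0")
  case True
  then show ?thesis
    using swp_0_family[of j C b] swp_0_family[of i C b] ij C transpose_commute[of i j] by auto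
next
  case False
  have "swp i j = swp i 0 \<circ> swp 0 j \<circ> swp i 0"
    by (rule transpose_comp_triple[symmetric]) (use ij False in auto)
  also have "\<dots> = swp 0 i \<circ> (swp 0 j \<circ> swp 0 i)" by (simp add: transpose_commute comp_assoc)
  finally have "perm_word (swp i j) x = perm_word (swp 0 i) (perm_word (swp 0 j) (perm_word (swp 0 i) x))" for x
    using ij by (simp add: perm_word_comp swp_permutes permutes_compose)
  then have "perm_word (swp i j) ` C = perm_word (swp 0 i) ` perm_word (swp 0 j) ` perm_word (swp 0 i) ` C"
    by (simp add: image_image)
  also have "\<dots> \<in> family (\<not> \<not> \<not> b)"
    using ij False C by (intro swp_0_family) auto
  finally show ?thesis by simp
qed

text \<open>Each transposition in a factorization of \<open>p\<close> exchanges the families;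
  \<open>b = evenperm p\<close> is \<open>b\<close> for even \<open>p\<close> and its negation for
  odd \<open>p\<close>.\<close>

lemma perm_word_family:
  assumes "p permutes {0..<8}" "C \<in> family b"
  shows "perm_word p ` C \<in> family (b = evenperm p)"
proof -
  have "\<forall>b. \<forall>C\<in>family b. perm_word p ` C \<in> family (b = evenperm p)"
    using assms(1) finite_atLeastLessThan
  proof (induction rule: permutes_induct)
    case id
    have "perm_word id ` C = C" if "C \<in> family b" for b C
    proof -
      have "perm_word id x = x" if "x \<in> C" for x
        using \<open>C \<in> family b\<close> that
        by (auto simp: family_def code_def even_vec_def perm_word_id)
      then show ?thesis by simp
    qed
    then show ?case by (simp del: id_apply)
  next
    case (swap i j p)
    have ev: "evenperm (swp i j \<circ> p) \<longleftrightarrow> \<not> evenperm p"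
      using swap by (simp add: evenperm_comp permutation_swap_id evenperm_swap permutes_imp_permutation[of "{0..<8}"])
    have im: "perm_word (swp i j \<circ> p) ` C = perm_word p ` perm_word (swp i j) ` C" for C
      using swap by (simp add: perm_word_comp image_image)
    show ?case
    proof (intro allI ballI)
      fix b C assume "C \<in> family b"
      then have "perm_word (swp i j) ` C \<in> family (\<not> b)"
        using swap by (intro swp_family) auto
      then have "perm_word p ` perm_word (swp i j) ` C \<in> family ((\<not> b) = evenperm p)"
        using swap by blast
      moreover have "((\<not> b) = evenperm p) = (b = evenperm (swp i j \<circ> p))" using ev by auto
      ultimately show "perm_word (swp i j \<circ> p) ` C \<in> family (b = evenperm (swp i j \<circ> p))"
        unfolding im by simp
    qed
  qed
  then show ?thesis using assms(2) by blast
qed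

section \<open>The base code and the vertex set of the second graph\<close>

lemma ham_eq: "ham a = map (\<lambda>i. ((bit a 0 \<and> bit i 0) \<noteq> (bit a 1 \<and> bit i 1)) \<noteq> (bit a 2 \<and> bit i 2)) [0..<8]"
proof -
  have "odd (card {k. k < 3 \<and> P k}) \<longleftrightarrow> (P 0 \<noteq> P 1) \<noteq> P 2" for P :: "nat \<Rightarrow> bool"
  proof -
    have "card {k. k < 3 \<and> P k} = (\<Sum>k<3. if P k then 1 else 0)"
      by (simp add: sum.If_cases lessThan_def Collect_conj_eq)
    also have "\<dots> = (if P 0 then 1 else 0) + (if P 1 then 1 else 0) + (if P 2 then 1 else 0)"
      by (simp add: eval_nat_numeral)
    finally show ?thesis by simp
  qed
  then show ?thesis by (simp add: ham_def)
qed

definition ham_words :: "bool list list" where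
  "ham_words =
    [[False, False, False, False, False, False, False, False],
     [False, True, False, True, False, True, False, True],
     [False, False, True, True, False, False, True, True],
     [False, True, True, False, False, True, True, False],
     [False, False, False, False, True, True, True, True],
     [False, True, False, True, True, False, True, False],
     [False, False, True, True, True, True, False, False],
     [False, True, True, False, True, False, False, True]]"

lemma map_ham: "map ham [0..<8] = ham_words"
  by (simp add: ham_words_def ham_eq upt_conv_Cons bit_numeral_rec(1) bit_iff_odd)

lemma ham_words_code: "list_all (\<lambda>x. x \<in> set (code_list False basev even_forms)) ham_words"
  by code_simp

text \<open>The eight words \<open>ham a\<close> start with \<open>False\<close>, so together with
  their complements they are 16 words inside a code of 16 words. Passing to points identifies each
  word with its complement.\<close>

lemma S0_eq: "S0 = pts (code False basev)"
proof -
  define H where "H = ham ` {..<8}"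
  have H: "H = set (map ham [0..<8])" by (auto simp: H_def)
  have hamC: "H \<subseteq> code False basev"
    using ham_words_code unfolding H map_ham code_list(1) list_all_iff by blast
  have CNot: "map Not x \<in> code False basev" if "x \<in> code False basev" for x
    using that coset_Not[of x basev zerov] by (simp add: code_def coset_def)
  have len: "length x = 8" if "x \<in> H" for x using that by (auto simp: H_def ham_def)
  have hd: "\<not> hd x" if "x \<in> H" for x using that by (auto simp: H_def ham_eq upt_conv_Cons)
  have "card H = 8"
    unfolding H by (subst distinct_card) (auto simp: map_ham ham_words_def)
  moreover have "card (map Not ` H) = card H"
    by (intro card_image inj_onI) (metis Not_Not)
  moreover have "H \<inter> map Not ` H = {}"
  proof -
    have "hd (map Not x)" if "x \<in> H" for x using hd[OF that] len[OF that] by (cases x) auto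
    then have "x \<notin> map Not ` H" if "x \<in> H" for x using hd[OF that] by (metis imageE)
    then show ?thesis by blast
  qed
  ultimately have "card (H \<union> map Not ` H) = 16" by (subst card_Un_disjoint) (auto simp: H)
  moreover have "basev \<noteq> zerov" by (simp add: basev_def zerov_def)
  ultimately have "H \<union> map Not ` H = code False basev"
    using hamC CNot card_code[of basev False] by (intro card_subset_eq) auto
  then have "pts (code False basev) = pts H \<union> pts (map Not ` H)"
    unfolding pts_def by (metis image_Un)
  moreover have "pts (map Not ` H) = pts H"
    unfolding pts_def image_image Not_Not by (simp only: insert_commute)
  moreover have "S0 = pts H" unfolding S0_def pts_def H_def by blast
  ultimately show ?thesis by simp
qed

lemma act_eq: "length a = 8 \<Longrightarrow> act \<sigma> a x = xorl (perm_word \<sigma> x) a"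
  by (rule nth_equalityI) (auto simp: act_def perm_word_def xorl_def)

lemma act_Not:
  assumes "\<sigma> permutes {0..<8}" "length x = 8"
  shows "act \<sigma> a (map Not x) = map Not (act \<sigma> a x)"
proof -
  have "\<sigma> i < 8" if "i < 8" for i using permutes_in_image[OF assms(1), of i] that by simp
  then show ?thesis using assms(2) by (auto simp: act_def)
qed

lemma translate_code:
  assumes "even_vec a"
  shows "(\<lambda>x. xorl x a) ` code False w = coset w (contract (form_of a) w)"
proof -
  have len: "length x = 8" if "even_vec x" for x using that by (simp add: even_vec_def)
  have 1: "xorl x a \<in> coset w (contract (form_of a) w)" if "x \<in> code False w" for x
    using that assms len by (auto simp: code_def coset_def even_vec_xorl form_of_xorl contract_addf)
  have 2: "xorl x a \<in> code False w" if "x \<in> coset w (contract (form_of a) w)" for x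
    using that assms len by (auto simp: code_def coset_def even_vec_xorl form_of_xorl contract_addf)
  have 3: "x = xorl (xorl x a) a" if "x \<in> coset w (contract (form_of a) w)" for x
    using that assms len by (simp add: coset_def xorl_xorl)
  show ?thesis using 1 2 3 by blast
qed

lemma act_S0:
  assumes g: "grp_elt \<sigma> a" and w: "perm_word \<sigma> ` code False basev = code False w"
  shows "(\<lambda>v. act \<sigma> a ` v) ` S0 = gvertex (w, contract (form_of a) w)"
proof -
  have g': "\<sigma> permutes {0..<8}" "even_vec a" "length a = 8"
    using g by (auto simp: grp_elt_def even_vec_def)
  have "(\<lambda>v. act \<sigma> a ` v) ` S0 = (\<lambda>x. {act \<sigma> a x, map Not (act \<sigma> a x)}) ` code False basev"
    unfolding S0_eq pts_def image_image
    by (rule image_cong) (auto simp: act_Not[OF g'(1)] code_def even_vec_def)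
  also have "\<dots> = pts ((\<lambda>x. xorl x a) ` perm_word \<sigma> ` code False basev)"
    unfolding pts_def image_image by (simp add: act_eq g')
  finally show ?thesis by (simp add: w translate_code[OF g'(2)] gvertex_def)
qed

lemma code_reachable:
  assumes w: "w \<noteq> zerov"
  shows "\<exists>\<sigma>. \<sigma> permutes {0..<8} \<and> evenperm \<sigma> \<and> perm_word \<sigma> ` code False basev = code False w"
proof -
  have bz: "basev \<noteq> zerov" by (simp add: basev_def zerov_def)
  then have C: "code False basev \<in> family False" by (auto simp: family_def)
  \<comment> \<open>\<open>perm_word_family\<close> makes the image a code of the same family, so
    the vanishing contractions give containment in \<open>code False w\<close> and the common size
    16 gives equality.\<close>
  have sub: ?thesis if s: "\<sigma> permutes {0..<8}" "evenperm \<sigma>"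
    and x: "\<And>x. x \<in> code False basev \<Longrightarrow> contract (form_of (perm_word \<sigma> x)) w = zerov" for \<sigma>
  proof -
    have "perm_word \<sigma> ` code False basev \<in> family False" using perm_word_family[OF s(1) C] s(2) by simp
    then obtain v where v: "v \<noteq> zerov" "perm_word \<sigma> ` code False basev = code False v"
      by (auto simp: family_def)
    have "code False v \<subseteq> code False w"
    proof
      fix y assume y: "y \<in> code False v"
      then obtain x where "x \<in> code False basev" "y = perm_word \<sigma> x" using v by blast
      then show "y \<in> code False w" using x y by (auto simp: code_def)
    qed
    then have "code False v = code False w"
      using card_code v(1) w by (intro card_subset_eq) auto
    then show ?thesis using s v by blast
  qed
  show ?thesis
  proof (cases "w = basev")
    case True
    have "perm_word id x = x" if "x \<in> code False basev" for x
      using that by (simp add: code_def even_vec_def perm_word_id)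
    then show ?thesis using True by (intro sub[of id]) (auto simp: permutes_id code_def)
  next
    case False
    obtain i j where ij: "i \<in> set [1, 2, 3, 4, 5, 6, 7]" "j \<in> set [1, 2, 3, 4, 5, 6, 7]" "i \<noteq> j"
      "\<forall>x\<in>code False basev. contract (form_of (perm_word (swp 0 j) (perm_word (swp 0 i) x))) w = zerov"
      using reach_check w False
      unfolding reach_check_def list_all_iff list_ex_iff set_f24_list code_list(1) by blast
    then have lt: "0 < i" "i < 8" "0 < j" "j < 8" by auto
    show ?thesis
    proof (rule sub)
      show "swp 0 i \<circ> swp 0 j permutes {0..<8}"
        using lt by (intro permutes_compose swp_permutes) auto
      show "evenperm (swp 0 i \<circ> swp 0 j)"
        using lt by (simp add: evenperm_comp permutation_swap_id evenperm_swap)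
      show "contract (form_of (perm_word (swp 0 i \<circ> swp 0 j) x)) w = zerov" if "x \<in> code False basev" for x
        using ij that lt by (simp add: perm_word_comp swp_permutes)
    qed
  qed
qed

text \<open>Even permutations move the base code exactly over the codes of its family, and
  translations move each code over its cosets. The pairs obtained have Q = 0 because \<omega>(v, v)
  = 0; conversely \<open>code_reachable\<close> and \<open>shift_check\<close> supply the
  permutation and the translation.\<close>

lemma Gamma1_V_eq: "Gamma1_V = gvertex ` model_V False"
proof (intro equalityI subsetI)
  fix S assume "S \<in> Gamma1_V"
  then obtain \<sigma> a where g: "grp_elt \<sigma> a" "S = (\<lambda>v. act \<sigma> a ` v) ` S0" by (auto simp: Gamma1_V_def)
  have "code False basev \<in> family False" by (auto simp: family_def basev_def zerov_def)
  then have "perm_word \<sigma> ` code False basev \<in> family False"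
    using perm_word_family[of \<sigma>] g(1) by (fastforce simp: grp_elt_def)
  then obtain w where "w \<noteq> zerov" "perm_word \<sigma> ` code False basev = code False w"
    by (auto simp: family_def)
  then have "S = gvertex (w, contract (form_of a) w)" "(w, contract (form_of a) w) \<in> model_V False"
    using act_S0[OF g(1)] g(2) dot_contract by (simp_all add: model_V_def)
  then show "S \<in> gvertex ` model_V False" by blast
next
  fix S assume "S \<in> gvertex ` model_V False"
  then obtain p where p: "p \<in> model_V False" "S = gvertex p" by blast
  obtain \<sigma> where s: "\<sigma> permutes {0..<8}" "evenperm \<sigma>" "perm_word \<sigma> ` code False basev = code False (fst p)"
    using code_reachable[of "fst p"] p by (auto simp: model_V_def)
  have "list_ex (\<lambda>(x, w). contract w (fst p) = snd p) even_forms"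
    using shift_check p(1) unfolding shift_check_def list_all_iff set_model_V_list by blast
  then obtain a where a: "even_vec a" "contract (form_of a) (fst p) = snd p"
    by (auto simp: list_ex_iff even_forms_def set_even_list)
  have g: "grp_elt \<sigma> a" using s a by (simp add: grp_elt_def)
  have "S = (\<lambda>v. act \<sigma> a ` v) ` S0" using act_S0[OF g s(3)] a(2) p(2) by simp
  then show "S \<in> Gamma1_V" using g by (auto simp: Gamma1_V_def)
qed

lemma bij_betw_gvertex: "bij_betw gvertex (model_V False) Gamma1_V"
  by (simp add: bij_betw_def inj_on_gvertex Gamma1_V_eq)

section \<open>Transfer of graph properties along isomorphisms\<close>

lemma graph_isomorphic_sym:
  assumes "graph_isomorphic V E W D"
  shows "graph_isomorphic W D V E"
proof -
  obtain f where f: "bij_betw f V W" "\<forall>x\<in>V. \<forall>y\<in>V. E x y = D (f x) (f y)"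
    using assms by (auto simp: graph_isomorphic_def)
  have "\<forall>x\<in>W. \<forall>y\<in>W. D x y = E (inv_into V f x) (inv_into V f y)"
    using f by (auto simp: bij_betw_def inv_into_into f_inv_into_f)
  then show ?thesis using bij_betw_inv_into[OF f(1)] by (auto simp: graph_isomorphic_def)
qed

lemma graph_isomorphic_trans:
  assumes "graph_isomorphic V E W D" "graph_isomorphic W D U F"
  shows "graph_isomorphic V E U F"
proof -
  obtain f where f: "bij_betw f V W" "\<forall>x\<in>V. \<forall>y\<in>V. E x y = D (f x) (f y)"
    using assms(1) by (auto simp: graph_isomorphic_def)
  obtain g where g: "bij_betw g W U" "\<forall>x\<in>W. \<forall>y\<in>W. D x y = F (g x) (g y)"
    using assms(2) by (auto simp: graph_isomorphic_def)
  have "\<forall>x\<in>V. \<forall>y\<in>V. E x y = F ((g \<circ> f) x) ((g \<circ> f) y)"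
    using f g bij_betwE[OF f(1)] by simp
  then show ?thesis using bij_betw_trans[OF f(1) g(1)] unfolding graph_isomorphic_def by blast
qed

lemma strongly_regular_isomorphic:
  assumes "graph_isomorphic V E W D" "strongly_regular V E n k l m"
  shows "strongly_regular W D n k l m"
proof -
  obtain f where f: "bij_betw f V W" and E: "\<forall>x\<in>V. \<forall>y\<in>V. E x y = D (f x) (f y)"
    using assms(1) by (auto simp: graph_isomorphic_def)
  have W: "W = f ` V" using f by (simp add: bij_betw_def)
  have inj: "f x = f y \<longleftrightarrow> x = y" if "x \<in> V" "y \<in> V" for x y
    using f that by (auto simp: bij_betw_def inj_on_def)
  have "card {y\<in>V. E x y} = card {y\<in>W. D (f x) y}" if "x \<in> V" for x
    by (rule bij_betw_same_card[of f], rule bij_betw_subset_Collect[OF f]) (use E that in auto)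
  moreover have "card {z\<in>V. E x z \<and> E y z} = card {z\<in>W. D (f x) z \<and> D (f y) z}" if "x \<in> V" "y \<in> V" for x y
    by (rule bij_betw_same_card[of f], rule bij_betw_subset_Collect[OF f]) (use E that in auto)
  ultimately show ?thesis
    using assms(2) E inj bij_betw_same_card[OF f] bij_betw_finite[OF f]
    unfolding strongly_regular_def simple_graph_def by (simp add: W)
qed

theorem theorem3p13:
  shows "quantum_isomorphic GE8_V GE8_E Gamma1_V Gamma1c_E \<and>
         \<not> graph_isomorphic GE8_V GE8_E Gamma1_V Gamma1c_E \<and>
         (\<exists>n k l m. strongly_regular GE8_V GE8_E n k l m) \<and>
         (\<exists>n k l m. strongly_regular Gamma1_V Gamma1c_E n k l m)"
proof -
  have iso1: "graph_isomorphic (model_V True) (model_E True) GE8_V GE8_E"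
    unfolding graph_isomorphic_def using bij_betw_e8_line GE8_E_e8_line by blast
  have iso2: "graph_isomorphic (model_V False) (model_E False) Gamma1_V Gamma1c_E"
    unfolding graph_isomorphic_def using bij_betw_gvertex Gamma1c_E_gvertex by blast
  have "quantum_isomorphic GE8_V GE8_E Gamma1_V Gamma1c_E"
    by (rule quantum_isomorphic_model_images[OF bij_betw_e8_line bij_betw_gvertex GE8_E_e8_line Gamma1c_E_gvertex])
  moreover have "\<not> graph_isomorphic GE8_V GE8_E Gamma1_V Gamma1c_E"
    using model_not_isomorphic graph_isomorphic_trans[OF graph_isomorphic_trans[OF iso1] graph_isomorphic_sym[OF iso2]]
    by blast
  ultimately show ?thesis
    using strongly_regular_isomorphic[OF iso1 model_strongly_regular]
      strongly_regular_isomorphic[OF iso2 model_strongly_regular] by blast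
qed

end
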